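(* Let $X$ be a curve over a finite field, $S$ a finite set of rational points, $C$ a divisor, and $Q_0,\ldots,Q_{r-1}\in S$. Define $C_0=C$ and $C_{i+1}=C_i+Q_i$ for $i=0,\ldots,r-1$. Then \[ \gamma^\ast(C;S)\geq\min\big(\{\gamma_{Q_0}(C_0;S),\gamma_{Q_1}(C_1;S),\ldots,\gamma_{Q_{r-1}}(C_{r-1};S),\gamma^\ast(C_r;S)\}\setminus\{0\}\big), \] and $\gamma^\ast(C_r;S)\geq\deg C+r$.
   Context: $L(E)=\{f:(f)+E\ge0\}\cup\{0\}$; for a rational point $P$, $\Gamma_P=\{A:L(A)\neq L(A-P)\}$ (divisor classes), and $\Gamma_S=\bigcap_{P\in S}\Gamma_P$. For $P\in S$: $\Gamma_P(C;S)=\{A\in\Gamma_S: A-C\in\Gamma_P\}$ and $\gamma_P(C;S)$ is the minimal degree of an element of $\Gamma_P(C;S)$. Also $\Gamma^\ast(C;S)=\{A\in\Gamma_S: L(A-C)\neq L(-C)\}$ and $\gamma^\ast(C;S)$ is the minimal degree of an element of $\Gamma^\ast(C;S)$.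
   Formalization: Since L(A−C)≠L(−C) depends on the divisor A and not only on its class, Γ*(C;S) is taken to be the classes in Γ_S that have an effective representative A with L(A−C)≠L(−C); for nonempty S this amounts to the dimensions of the two spaces being different. *)

theory Defs
  imports
    "HOL-Algebra.Algebraic_Closure_Type"
    "HOL-Algebra.Generated_Fields"
    "HOL-Algebra.Free_Abelian_Groups"
    "HOL-Library.Extended_Real"
begin

text \<open>
  A (smooth, projective, absolutely irreducible) curve over a finite field is given by its
  function field: the type \<open>'f\<close> is the field of rational functions and \<open>K\<close> the
  finite field of constants. Since \<open>K\<close> is perfect, absolute irreducibility amounts to
  \<open>K\<close> being algebraically closed in \<open>'f\<close>.
\<close>

abbreviation fring :: "'f::field ring" where
  "fring \<equiv> ring_of_type_algebra"

locale finite_field_curve =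
  fixes K :: "'f::field set"
  assumes subfield_K: "subfield K (fring :: 'f ring)"
    and finite_K: "finite K"
    and full_constants: "\<And>x :: 'f. ring.algebraic fring K x \<Longrightarrow> x \<in> K"
    and function_field: "\<exists>x :: 'f. ring.transcendental fring K x \<and>
          ring.finite_dimension fring (generate_field fring (insert x K)) UNIV"

text \<open>
  A closed point of the curve is identified with its order function \<open>v\<close>, a normalized
  discrete valuation of the function field that is trivial on the constants. The value
  \<open>v 0\<close>, mathematically infinite, is fixed to be \<open>0\<close>, so that distinct
  functions are distinct points; every use of \<open>v f\<close> below is guarded by
  \<open>f \<noteq> 0\<close>.
\<close>

type_synonym 'f point = "'f \<Rightarrow> int"

definition points :: "'f::field set \<Rightarrow> 'f point set" where
  "points K = {v. v 0 = 0
     \<and> (\<forall>f g. f \<noteq> 0 \<and> g \<noteq> 0 \<longrightarrow> v (f * g) = v f + v g)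
     \<and> (\<forall>f g. f \<noteq> 0 \<and> g \<noteq> 0 \<and> f + g \<noteq> 0 \<longrightarrow> min (v f) (v g) \<le> v (f + g))
     \<and> (\<exists>t. t \<noteq> 0 \<and> v t = 1)
     \<and> (\<forall>c\<in>K. c \<noteq> 0 \<longrightarrow> v c = 0)}"

definition local_ring :: "'f::field point \<Rightarrow> 'f ring" where
  "local_ring v = fring\<lparr>carrier := {f. f = 0 \<or> 0 \<le> v f}\<rparr>"

definition max_ideal :: "'f::field point \<Rightarrow> 'f set" where
  "max_ideal v = {f. f = 0 \<or> 1 \<le> v f}"

definition residue_field :: "'f::field point \<Rightarrow> 'f set ring" where
  "residue_field v = local_ring v Quot max_ideal v"

definition point_degree :: "'f::field set \<Rightarrow> 'f point \<Rightarrow> nat" where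
  "point_degree K v = ring.dim (residue_field v)
     ((\<lambda>c. max_ideal v +>\<^bsub>local_ring v\<^esub> c) ` K) (carrier (residue_field v))"

definition rational_points :: "'f::field set \<Rightarrow> 'f point set" where
  "rational_points K = {P \<in> points K. point_degree K P = 1}"

text \<open>
  Divisors are elements of the free abelian group on the points; \<open>frag_of P\<close> is the
  point \<open>P\<close> regarded as a divisor.
\<close>

type_synonym 'f divisor = "'f point \<Rightarrow>\<^sub>0 int"

definition divisors :: "'f::field set \<Rightarrow> 'f divisor set" where
  "divisors K = {D. Poly_Mapping.keys D \<subseteq> points K}"

definition effective :: "'f divisor \<Rightarrow> bool" where
  "effective D \<longleftrightarrow> (\<forall>P. 0 \<le> Poly_Mapping.lookup D P)"

definition divisor_degree :: "'f::field set \<Rightarrow> 'f divisor \<Rightarrow> int" where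
  "divisor_degree K D =
     (\<Sum>P\<in>Poly_Mapping.keys D. Poly_Mapping.lookup D P * int (point_degree K P))"

text \<open>The principal divisor \<open>(f)\<close> has the coefficient \<open>P f\<close> at the point \<open>P\<close>.\<close>

definition RR_space :: "'f::field set \<Rightarrow> 'f divisor \<Rightarrow> 'f set" where
  "RR_space K E = {f. f \<noteq> 0 \<and> (\<forall>P\<in>points K. 0 \<le> P f + Poly_Mapping.lookup E P)} \<union> {0}"

definition linear_equivalence :: "'f::field set \<Rightarrow> ('f divisor \<times> 'f divisor) set" where
  "linear_equivalence K = {(A, B). A \<in> divisors K \<and> B \<in> divisors K \<and>
     (\<exists>f. f \<noteq> 0 \<and> (\<forall>P\<in>points K. Poly_Mapping.lookup (A - B) P = P f))}"

definition divisor_classes :: "'f::field set \<Rightarrow> 'f divisor set set" where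
  "divisor_classes K = divisors K // linear_equivalence K"

text \<open>Linearly equivalent divisors have the same degree, so the image below is a singleton.\<close>

definition class_degree :: "'f::field set \<Rightarrow> 'f divisor set \<Rightarrow> int" where
  "class_degree K a = the_elem (divisor_degree K ` a)"

text \<open>The class of \<open>A - C\<close>, where \<open>a\<close> is the class of \<open>A\<close>.\<close>

definition class_minus :: "'f divisor set \<Rightarrow> 'f divisor \<Rightarrow> 'f divisor set" where
  "class_minus a C = (\<lambda>A. A - C) ` a"

text \<open>The condition \<open>L(A) \<noteq> L(A - P)\<close> does not depend on the representative \<open>A\<close>.\<close>

definition Gamma_pt :: "'f::field set \<Rightarrow> 'f point \<Rightarrow> 'f divisor set set" where
  "Gamma_pt K P = {a \<in> divisor_classes K.
     \<exists>A\<in>a. RR_space K A \<noteq> RR_space K (A - frag_of P)}"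

definition Gamma_set :: "'f::field set \<Rightarrow> 'f point set \<Rightarrow> 'f divisor set set" where
  "Gamma_set K S = {a \<in> divisor_classes K. \<forall>P\<in>S. a \<in> Gamma_pt K P}"

definition Gamma_rel ::
    "'f::field set \<Rightarrow> 'f point \<Rightarrow> 'f divisor \<Rightarrow> 'f point set \<Rightarrow> 'f divisor set set" where
  "Gamma_rel K P C S = {a \<in> Gamma_set K S. class_minus a C \<in> Gamma_pt K P}"

text \<open>
  The condition \<open>L(A - C) \<noteq> L(-C)\<close> compares two subspaces of the function field and is
  not invariant under replacing \<open>A\<close> by an arbitrary equivalent divisor (a nonzero principal
  \<open>A\<close> can satisfy it, although its class is that of \<open>0\<close>). It is therefore read for an
  effective representative \<open>A\<close>, for which \<open>L(-C) \<subseteq> L(A - C)\<close>; there it says that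
  the dimensions differ, and so does not depend on which effective representative is taken.
  If \<open>S\<close> is nonempty, every class in \<open>Gamma_set K S\<close> has an effective representative.
\<close>

definition Gamma_star ::
    "'f::field set \<Rightarrow> 'f divisor \<Rightarrow> 'f point set \<Rightarrow> 'f divisor set set" where
  "Gamma_star K C S = {a \<in> Gamma_set K S.
     \<exists>A\<in>a. effective A \<and> RR_space K (A - C) \<noteq> RR_space K (- C)}"

text \<open>
  The minimal degree as an extended real: over a nonempty set of classes with degrees bounded
  below the infimum is attained, over the empty set it is \<open>\<infinity>\<close>.
\<close>

definition min_degree :: "'f::field set \<Rightarrow> 'f divisor set set \<Rightarrow> ereal" where
  "min_degree K G = (INF a\<in>G. ereal (of_int (class_degree K a)))"

definition gamma_pt ::
    "'f::field set \<Rightarrow> 'f point \<Rightarrow> 'f divisor \<Rightarrow> 'f point set \<Rightarrow> ereal" where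
  "gamma_pt K P C S = min_degree K (Gamma_rel K P C S)"

definition gamma_star :: "'f::field set \<Rightarrow> 'f divisor \<Rightarrow> 'f point set \<Rightarrow> ereal" where
  "gamma_star K C S = min_degree K (Gamma_star K C S)"

end

theory Submission
  imports Defs
begin

text \<open>
  Since the constant field \<open>K\<close> is finite, dimensions can be replaced by cardinalities. The main
  tool is that \<open>L(D) \<noteq> 0\<close> implies \<open>deg D \<ge> 0\<close>. If \<open>T\<close> is a set of
  pairwise incongruent elements modulo an element \<open>g\<close> of a subring, the sums
  \<open>a\<^sub>0 + a\<^sub>1 g + \<dots> + a\<^sub>m\<^sub>-\<^sub>1 g\<^sup>m\<^sup>-\<^sup>1\<close>
  with digits in \<open>T\<close> are pairwise distinct, so any bound of the form \<open>E C\<^sup>m\<close> for their number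
  gives \<open>|T| \<le> C\<close>. Finiteness of the field over \<open>K(x)\<close> gives such a bound for every \<open>g\<close>; this
  yields finite residue fields, finitely many zeros and poles, and the existence of a pole for every
  nonconstant function. For a nonzero \<open>g\<close> in \<open>L(D)\<close> the bound comes from the Riemann-Roch spaces
  themselves and compares the negative with the positive part of \<open>D\<close>.

  For the proposition, take an effective \<open>A\<close> in a class of \<open>\<Gamma>\<^sup>*(C;S)\<close>. If
  \<open>L(A - C\<^sub>r) = L(-C\<^sub>r)\<close>, consider a step \<open>i\<close> at which \<open>L(A - C\<^sub>i) \<noteq> L(-C\<^sub>i)\<close> turns into
  equality. Since \<open>Q\<^sub>i\<close> is rational, \<open>L(A - C\<^sub>i)\<close> drops at this step while \<open>L(-C\<^sub>i)\<close> does not. The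
  former puts the class into \<open>\<Gamma>\<^sub>Q(C\<^sub>i;S)\<close> for \<open>Q = Q\<^sub>i\<close>, and the latter excludes the zero class
  from that set, so that the corresponding minimum is not \<open>0\<close>.
\<close>

section \<open>Subrings and spans in a field\<close>

lemma carrier_fring [simp]: "carrier fring = UNIV"
  and mult_fring [simp]: "x \<otimes>\<^bsub>fring\<^esub> y = x * y"
  and one_fring [simp]: "\<one>\<^bsub>fring\<^esub> = 1"
  and zero_fring [simp]: "\<zero>\<^bsub>fring\<^esub> = 0"
  and add_fring [simp]: "x \<oplus>\<^bsub>fring\<^esub> y = x + y"
  by (simp_all add: ring_of_type_algebra_def)

interpretation fring: domain "fring :: 'f::field ring"
  by (rule field.axioms(1)[OF field_from_type_algebra])

lemma a_inv_fring [simp]: "\<ominus>\<^bsub>fring\<^esub> (x :: 'f::field) = - x"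
  using fring.minus_equality[of "- x" x] by simp

lemma m_inv_fring [simp]: "(x :: 'f::field) \<noteq> 0 \<Longrightarrow> inv\<^bsub>fring\<^esub> x = inverse x"
  using fring.inv_unique'[of x "inverse x"] by simp

lemma subring_fringI:
  fixes R :: "'f::field set"
  assumes "1 \<in> R" "\<And>a b. a \<in> R \<Longrightarrow> b \<in> R \<Longrightarrow> a - b \<in> R" "\<And>a b. a \<in> R \<Longrightarrow> b \<in> R \<Longrightarrow> a * b \<in> R"
  shows "subring R fring"
proof -
  have "0 \<in> R" using assms(2)[OF assms(1,1)] by simp
  then have uminus: "- a \<in> R" if "a \<in> R" for a using assms(2)[of 0 a] that by simp
  then have "a + b \<in> R" if "a \<in> R" "b \<in> R" for a b using assms(2)[of a "- b"] that by simp
  then show ?thesis by (intro fring.subringI) (use assms uminus in auto)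
qed

lemma subring_fringD:
  fixes R :: "'f::field set"
  assumes "subring R fring"
  shows "0 \<in> R" "1 \<in> R" "a \<in> R \<Longrightarrow> - a \<in> R" "a \<in> R \<Longrightarrow> b \<in> R \<Longrightarrow> a + b \<in> R"
    "a \<in> R \<Longrightarrow> b \<in> R \<Longrightarrow> a - b \<in> R" "a \<in> R \<Longrightarrow> b \<in> R \<Longrightarrow> a * b \<in> R" "a \<in> R \<Longrightarrow> a ^ n \<in> R"
proof -
  note R = subringE(2-7)[OF assms, simplified]
  show "0 \<in> R" "1 \<in> R" "a \<in> R \<Longrightarrow> - a \<in> R" "a \<in> R \<Longrightarrow> b \<in> R \<Longrightarrow> a + b \<in> R"
    "a \<in> R \<Longrightarrow> b \<in> R \<Longrightarrow> a * b \<in> R" by (auto intro: R)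
  show "a \<in> R \<Longrightarrow> b \<in> R \<Longrightarrow> a - b \<in> R" using R(4)[of b] R(6)[of a "- b"] by simp
  show "a \<in> R \<Longrightarrow> a ^ n \<in> R" by (induction n) (auto intro: R)
qed

definition fractions :: "'f::field set \<Rightarrow> 'f set" where
  "fractions R = {c. \<exists>b\<in>R. b \<noteq> 0 \<and> b * c \<in> R}"

lemma subset_fractions:
  assumes "subring R fring" shows "R \<subseteq> fractions R"
  using subring_fringD(2)[OF assms] by (auto simp: fractions_def intro: bexI[of _ 1])

lemma subfield_fractions:
  fixes R :: "'f::field set"
  assumes R: "subring R fring"
  shows "subfield (fractions R) fring"
proof (rule field.subfieldI'[OF field_from_type_algebra])
  note R = subring_fringD[OF R]
  show "subring (fractions R) fring"
  proof (rule subring_fringI)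
    show "1 \<in> fractions R" using subset_fractions[OF assms] R(2) by blast
    fix c c' :: 'f assume "c \<in> fractions R" "c' \<in> fractions R"
    then obtain b b' where b: "b \<in> R" "b \<noteq> 0" "b * c \<in> R" and b': "b' \<in> R" "b' \<noteq> 0" "b' * c' \<in> R"
      unfolding fractions_def by blast
    have "b * b' * (c - c') = b' * (b * c) - b * (b' * c')"
      and "b * b' * (c * c') = (b * c) * (b' * c')" by (simp_all add: algebra_simps)
    then have "b * b' * (c - c') \<in> R" "b * b' * (c * c') \<in> R"
      using R(5,6) b b' by metis+
    moreover have "b * b' \<in> R" "b * b' \<noteq> 0" using R(6) b b' by simp_all
    ultimately show "c - c' \<in> fractions R" "c * c' \<in> fractions R"
      unfolding fractions_def by blast+
  qed
  fix c :: 'f assume "c \<in> fractions R - {\<zero>\<^bsub>fring\<^esub>}"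
  then obtain b where b: "b \<in> R" "b \<noteq> 0" "b * c \<in> R" and c: "c \<noteq> 0"
    unfolding fractions_def by auto
  have "b * c * inverse c = b" using c by simp
  then have "inverse c \<in> fractions R"
    unfolding fractions_def using b c by (metis (mono_tags, lifting) mem_Collect_eq mult_eq_0_iff)
  then show "inv\<^bsub>fring\<^esub> c \<in> fractions R" using c by simp
qed

lemma Span_fring_Nil [simp]: "fring.Span K [] = {0 :: 'f::field}"
  by simp

lemma Span_fring_Cons [simp]:
  "fring.Span K (u # us) = {k * u + s |k s. k \<in> K \<and> s \<in> fring.Span K us}" for u :: "'f::field"
  by (auto simp: fring.line_extension_def set_add_def' r_coset_def)

declare fring.Span.simps [simp del]

lemma Span_fring_ConsI:
  "k \<in> K \<Longrightarrow> s \<in> fring.Span K us \<Longrightarrow> k * u + s \<in> fring.Span K (u # us)" for u :: "'f::field"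
  by auto

lemma Span_fring_mono: "K \<subseteq> L \<Longrightarrow> fring.Span K us \<subseteq> fring.Span L (us :: 'f::field list)"
  by (induction us) auto

lemma Span_fring_add:
  fixes us :: "'f::field list"
  assumes K: "\<And>k l. k \<in> K \<Longrightarrow> l \<in> K \<Longrightarrow> k + l \<in> K"
  shows "a \<in> fring.Span K us \<Longrightarrow> b \<in> fring.Span K us \<Longrightarrow> a + b \<in> fring.Span K us"
proof (induction us arbitrary: a b)
  case (Cons u us)
  then obtain k s l t where "a = k * u + s" "b = l * u + t" "k + l \<in> K" "s + t \<in> fring.Span K us"
    using K by auto
  moreover from this have "a + b = (k + l) * u + (s + t)" by (simp add: algebra_simps)
  ultimately show ?case using Span_fring_ConsI by metis
qed simp

lemma Span_fring_zero: "0 \<in> K \<Longrightarrow> 0 \<in> fring.Span K (us :: 'f::field list)"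
proof (induction us)
  case (Cons u us)
  then show ?case using Span_fring_ConsI[of 0 K 0 us u] by simp
qed simp

lemma Span_fring_mult:
  fixes us :: "'f::field list"
  assumes "\<And>k. k \<in> K \<Longrightarrow> f * k \<in> L"
  shows "a \<in> fring.Span K us \<Longrightarrow> f * a \<in> fring.Span L us"
proof (induction us arbitrary: a)
  case (Cons u us)
  then obtain k s where "a = k * u + s" "f * k \<in> L" "f * s \<in> fring.Span L us"
    using assms by auto
  moreover from this have "f * a = (f * k) * u + f * s" by (simp add: algebra_simps)
  ultimately show ?case using Span_fring_ConsI by metis
qed simp

lemma card_Span_fring_le:
  fixes us :: "'f::field list"
  assumes "finite K"
  shows "finite (fring.Span K us) \<and> card (fring.Span K us) \<le> card K ^ length us"
proof (induction us)
  case (Cons u us)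
  have eq: "fring.Span K (u # us) = (\<lambda>(k, s). k * u + s) ` (K \<times> fring.Span K us)"
    by force
  have "finite (K \<times> fring.Span K us)" using assms Cons by blast
  from finite_imageI[OF this] card_image_le[OF this, of "\<lambda>(k, s). k * u + s"]
  show ?case unfolding eq using Cons
    by (auto simp: card_cartesian_product intro: order_trans mult_le_mono2)
qed simp

section \<open>Residue systems\<close>

definition incongruent :: "'a::ab_group_add set \<Rightarrow> 'a set \<Rightarrow> bool" where
  "incongruent I T \<longleftrightarrow> (\<forall>a\<in>T. \<forall>b\<in>T. a - b \<in> I \<longrightarrow> a = b)"

definition index_le :: "'a::ab_group_add set \<Rightarrow> 'a set \<Rightarrow> nat \<Rightarrow> bool" where
  "index_le I R C \<longleftrightarrow> (\<forall>T\<subseteq>R. finite T \<longrightarrow> incongruent I T \<longrightarrow> card T \<le> C)"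

definition residue_system :: "'a::ab_group_add set \<Rightarrow> 'a set \<Rightarrow> 'a set \<Rightarrow> bool" where
  "residue_system I R T \<longleftrightarrow>
     finite T \<and> T \<subseteq> R \<and> incongruent I T \<and> (\<forall>r\<in>R. \<exists>a\<in>T. r - a \<in> I)"

lemma residue_system_covers: "residue_system I R T \<Longrightarrow> r \<in> R \<Longrightarrow> \<exists>a\<in>T. r - a \<in> I"
  by (simp add: residue_system_def)

lemma incongruentD: "incongruent I T \<Longrightarrow> a \<in> T \<Longrightarrow> b \<in> T \<Longrightarrow> a - b \<in> I \<Longrightarrow> a = b"
  by (auto simp: incongruent_def)

lemma incongruent_antimono: "incongruent J T \<Longrightarrow> I \<subseteq> J \<Longrightarrow> incongruent I T"
  by (auto simp: incongruent_def)

lemma index_leD: "index_le I R C \<Longrightarrow> T \<subseteq> R \<Longrightarrow> finite T \<Longrightarrow> incongruent I T \<Longrightarrow> card T \<le> C"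
  by (simp add: index_le_def)

context
  fixes I :: "'a::ab_group_add set"
  assumes zero_closed: "0 \<in> I" and diff_closed: "\<And>a b. a \<in> I \<Longrightarrow> b \<in> I \<Longrightarrow> a - b \<in> I"
begin

lemma congruent_sym: "a - b \<in> I \<Longrightarrow> b - a \<in> I"
  using diff_closed[OF zero_closed, of "a - b"] by simp

lemma congruent_if_common_residue: "a - c \<in> I \<Longrightarrow> b - c \<in> I \<Longrightarrow> a - b \<in> I"
  using diff_closed[of "a - c" "b - c"] by simp

lemma residue_system_exists:
  assumes "index_le I R C"
  shows "\<exists>T. residue_system I R T"
proof -
  define P where "P T \<longleftrightarrow> T \<subseteq> R \<and> finite T \<and> incongruent I T" for T
  have "P {}" by (simp add: P_def incongruent_def)
  moreover have "\<forall>T. P T \<longrightarrow> card T < Suc C"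
    using index_leD[OF assms] by (simp add: P_def le_imp_less_Suc)
  ultimately obtain T where T: "P T" and max: "\<And>T'. P T' \<Longrightarrow> card T' \<le> card T"
    using ex_has_greatest_nat[of P "{}" card "Suc C"] by metis
  have "\<exists>a\<in>T. r - a \<in> I" if "r \<in> R" for r
  proof (rule ccontr)
    assume no: "\<not> ?thesis"
    then have "P (insert r T)"
      using T \<open>r \<in> R\<close> congruent_sym unfolding P_def incongruent_def by blast
    moreover have "r \<notin> T" using no zero_closed by auto
    ultimately show False using max[of "insert r T"] T by (simp add: P_def)
  qed
  then show ?thesis using T by (auto simp: P_def residue_system_def)
qed

lemma card_incongruent_le:
  assumes T: "residue_system I R T" and S: "S \<subseteq> R" "incongruent I S"
  shows "finite S \<and> card S \<le> card T"
proof -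
  have "\<forall>s\<in>S. \<exists>a\<in>T. s - a \<in> I" using T S(1) unfolding residue_system_def by blast
  then obtain \<rho> where \<rho>: "\<And>s. s \<in> S \<Longrightarrow> \<rho> s \<in> T \<and> s - \<rho> s \<in> I" by metis
  then have "inj_on \<rho> S"
    by (intro inj_onI) (metis S(2) incongruentD congruent_if_common_residue)
  moreover have "\<rho> ` S \<subseteq> T" using \<rho> by blast
  ultimately show ?thesis
    using T inj_on_finite card_inj_on_le unfolding residue_system_def by metis
qed

lemma residue_system_if_card_eq:
  assumes T: "residue_system I R T" and S: "S \<subseteq> R" "incongruent I S" "card S = card T"
  shows "residue_system I R S"
proof -
  have finS: "finite S" using card_incongruent_le[OF T S(1,2)] by blast
  have "\<exists>s\<in>S. r - s \<in> I" if r: "r \<in> R" for r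
  proof (rule ccontr)
    assume no: "\<not> ?thesis"
    then have "incongruent I (insert r S)"
      using S(2) congruent_sym unfolding incongruent_def by blast
    from card_incongruent_le[OF T _ this] have "card (insert r S) \<le> card S"
      using r S(1,3) by simp
    then have "r \<in> S" using finS by (metis card_insert_disjoint Suc_n_not_le_n)
    then show False using no zero_closed by force
  qed
  then show ?thesis using finS S by (simp add: residue_system_def)
qed

lemma card_le_index_mult_card:
  assumes G: "\<And>a b. a \<in> G \<Longrightarrow> b \<in> G \<Longrightarrow> a - b \<in> G" and index: "index_le I G C"
    and fin: "finite (G \<inter> I)"
  shows "finite G \<and> card G \<le> C * card (G \<inter> I)"
proof -
  obtain T where T: "residue_system I G T" using residue_system_exists[OF index] ..
  then have cardT: "finite T" "card T \<le> C"
    using index_leD[OF index] by (auto simp: residue_system_def)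
  let ?sum = "\<lambda>(a, h). a + h"
  have sub: "G \<subseteq> ?sum ` (T \<times> (G \<inter> I))"
  proof
    fix g assume g: "g \<in> G"
    then obtain a where a: "a \<in> T" "g - a \<in> I" using T unfolding residue_system_def by blast
    then have "g - a \<in> G" using T g G by (auto simp: residue_system_def)
    then show "g \<in> ?sum ` (T \<times> (G \<inter> I))" using a by (auto intro!: image_eqI[of _ _ "(a, g - a)"])
  qed
  have prod: "finite (T \<times> (G \<inter> I))" using cardT fin by simp
  have "card G \<le> card (T \<times> (G \<inter> I))" by (rule surj_card_le[OF prod sub])
  also have "\<dots> \<le> C * card (G \<inter> I)" using cardT(2) by (simp add: card_cartesian_product)
  finally show ?thesis using finite_subset[OF sub] prod by blast
qed

end

section \<open>Digit sums\<close>

fun digit_sums :: "'a::comm_ring_1 set \<Rightarrow> 'a \<Rightarrow> nat \<Rightarrow> 'a set" where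
  "digit_sums D g 0 = {0}"
| "digit_sums D g (Suc m) = {a + g * s |a s. a \<in> D \<and> s \<in> digit_sums D g m}"

lemma digit_sums_Suc_top:
  "digit_sums D g (Suc m) = {s + a * g ^ m |s a. s \<in> digit_sums D g m \<and> a \<in> D}"
proof (induction m)
  case (Suc m)
  have "digit_sums D g (Suc (Suc m))
      = {a + g * (s + b * g ^ m) |a s b. a \<in> D \<and> s \<in> digit_sums D g m \<and> b \<in> D}"
    using Suc.IH by auto
  also have "\<dots> = {(a + g * s) + b * g ^ Suc m |a s b. a \<in> D \<and> s \<in> digit_sums D g m \<and> b \<in> D}"
    by (simp add: algebra_simps)
  also have "\<dots> = {s + b * g ^ Suc m |s b. s \<in> digit_sums D g (Suc m) \<and> b \<in> D}"
    by auto
  finally show ?case .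
qed auto

lemma card_digit_sums_le:
  assumes "finite D" shows "finite (digit_sums D g m) \<and> card (digit_sums D g m) \<le> card D ^ m"
proof (induction m)
  case (Suc m)
  have eq: "digit_sums D g (Suc m) = (\<lambda>(a, s). a + g * s) ` (D \<times> digit_sums D g m)"
    by force
  have "finite (D \<times> digit_sums D g m)" using assms Suc by blast
  from finite_imageI[OF this] card_image_le[OF this, of "\<lambda>(a, s). a + g * s"]
  show ?case unfolding eq using Suc
    by (auto simp: card_cartesian_product intro: order_trans mult_le_mono2)
qed simp

lemma digit_sums_SucI: "a \<in> D \<Longrightarrow> s \<in> digit_sums D g m \<Longrightarrow> a + g * s \<in> digit_sums D g (Suc m)"
  by auto

context
  fixes R :: "'f::field set" and x :: 'f
  assumes R: "subring R fring"
begin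

lemma digit_sums_zero: "0 \<in> digit_sums R x m"
proof (induction m)
  case (Suc m)
  show ?case using digit_sums_SucI[OF subring_fringD(1)[OF R] Suc] by simp
qed simp

lemma digit_sums_add: "p \<in> digit_sums R x m \<Longrightarrow> q \<in> digit_sums R x m \<Longrightarrow> p + q \<in> digit_sums R x m"
proof (induction m arbitrary: p q)
  case (Suc m)
  then obtain a s b t where "p = a + x * s" "q = b + x * t" "a + b \<in> R" "s + t \<in> digit_sums R x m"
    using subring_fringD(4)[OF R] by auto
  moreover from this have "p + q = (a + b) + x * (s + t)" by (simp add: algebra_simps)
  ultimately show ?case using digit_sums_SucI by metis
qed simp

lemma digit_sums_scale: "c \<in> R \<Longrightarrow> p \<in> digit_sums R x m \<Longrightarrow> c * p \<in> digit_sums R x m"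
proof (induction m arbitrary: p)
  case (Suc m)
  then obtain a s where "p = a + x * s" "c * a \<in> R" "c * s \<in> digit_sums R x m"
    using subring_fringD(6)[OF R] by auto
  moreover from this have "c * p = c * a + x * (c * s)" by (simp add: algebra_simps)
  ultimately show ?case using digit_sums_SucI by metis
qed simp

lemma digit_sums_mono:
  assumes "m \<le> n" shows "digit_sums R x m \<subseteq> digit_sums R x n"
proof (rule lift_Suc_mono_le[OF _ assms])
  show "digit_sums R x n \<subseteq> digit_sums R x (Suc n)" for n
    unfolding digit_sums_Suc_top using subring_fringD(1)[OF R] by force
qed

lemma digit_sums_mult:
  "p \<in> digit_sums R x m \<Longrightarrow> q \<in> digit_sums R x n \<Longrightarrow> p * q \<in> digit_sums R x (m + n)"
proof (induction m arbitrary: p)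
  case 0
  then show ?case using digit_sums_zero by simp
next
  case (Suc m)
  then obtain a s where p: "p = a + x * s" "a \<in> R" "s * q \<in> digit_sums R x (m + n)" by auto
  have "a * q \<in> digit_sums R x (Suc (m + n))"
    using digit_sums_scale[OF p(2) Suc.prems(2)] digit_sums_mono[of n "Suc (m + n)"] by auto
  moreover have "x * (s * q) \<in> digit_sums R x (Suc (m + n))"
    using p(3) subring_fringD(1)[OF R] by force
  ultimately have "a * q + x * (s * q) \<in> digit_sums R x (Suc (m + n))" by (rule digit_sums_add)
  then show ?case by (simp add: p(1) algebra_simps)
qed

lemma simple_extension_eq_digit_sums: "fring.simple_extension R x = (\<Union>m. digit_sums R x m)"
proof
  show "fring.simple_extension R x \<subseteq> (\<Union>m. digit_sums R x m)"
  proof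
    fix p assume "p \<in> fring.simple_extension R x"
    then show "p \<in> (\<Union>m. digit_sums R x m)"
    proof induction
      case zero
      then show ?case using digit_sums_zero by auto
    next
      case (lin p a)
      then obtain m where "p \<in> digit_sums R x m" by auto
      then have "a + x * p \<in> digit_sums R x (Suc m)" by (rule digit_sums_SucI[OF lin.hyps(2)])
      then have "p \<otimes>\<^bsub>fring\<^esub> x \<oplus>\<^bsub>fring\<^esub> a \<in> digit_sums R x (Suc m)"
        by (simp only: mult_fring add_fring add.commute[of a] mult.commute[of x])
      then show ?case by blast
    qed
  qed
  have "digit_sums R x m \<subseteq> fring.simple_extension R x" for m
  proof (induction m)
    case 0
    then show ?case using fring.simple_extension.zero[of R x] by simp
  next
    case (Suc m)
    then show ?case
      using fring.simple_extension.lin[of _ R x] by (auto simp: add.commute mult.commute)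
  qed
  then show "(\<Union>m. digit_sums R x m) \<subseteq> fring.simple_extension R x" by blast
qed

end

lemma digit_sums_reverse:
  fixes V :: "'f::field set"
  assumes V: "subring V fring" and "u \<noteq> 0"
  shows "s \<in> digit_sums V (inverse u) m \<Longrightarrow> m \<le> n \<Longrightarrow> u ^ n * (inverse u * s) \<in> digit_sums V u n"
proof (induction m arbitrary: n s)
  case 0
  then show ?case using digit_sums_zero[OF V] by simp
next
  case (Suc m)
  then obtain a s' l where s: "s = a + inverse u * s'" "a \<in> V" "s' \<in> digit_sums V (inverse u) m"
    and n: "n = Suc l" "m \<le> l" by (auto dest: Suc_le_D)
  have "u ^ n * (inverse u * s) = u ^ l * s" using assms(2) by (simp add: n(1))
  also have "\<dots> = u ^ l * (inverse u * s') + a * u ^ l" by (simp add: s(1) algebra_simps)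
  finally show ?case
    unfolding n(1) digit_sums_Suc_top using Suc.IH[OF s(3) n(2)] s(2) by blast
qed

section \<open>Growth of digit sums\<close>

definition digit_growth_le :: "'f::field \<Rightarrow> nat \<Rightarrow> bool" where
  "digit_growth_le g C \<longleftrightarrow> (\<forall>T. finite T \<longrightarrow> (\<exists>E. \<forall>m. card (digit_sums T g m) \<le> E * C ^ m))"

lemma digit_sums_subset_subring:
  fixes R :: "'f::field set"
  assumes "subring R fring" "g \<in> R" "T \<subseteq> R"
  shows "digit_sums T g m \<subseteq> R"
proof (induction m)
  case (Suc m)
  then show ?case using assms(2,3) subring_fringD(4,6)[OF assms(1)] by (auto simp: subset_iff)
qed (use subring_fringD(1)[OF assms(1)] in simp)

lemma card_digit_sums_incongruent:
  fixes R :: "'f::field set"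
  assumes R: "subring R fring" and g: "g \<in> R" "g \<noteq> 0"
    and T: "T \<subseteq> R" "incongruent ((*) g ` R) T"
  shows "card (digit_sums T g m) = card T ^ m"
proof (induction m)
  case (Suc m)
  let ?S = "digit_sums T g m"
  have "inj_on (\<lambda>(a, s). a + g * s) (T \<times> ?S)"
  proof (rule inj_onI, clarify)
    fix a s b t assume a: "a \<in> T" "b \<in> T" and s: "s \<in> ?S" "t \<in> ?S" and eq: "a + g * s = b + g * t"
    then have "t - s \<in> R"
      using digit_sums_subset_subring[OF R g(1) T(1)] subring_fringD(5)[OF R] by blast
    moreover have "a - b = g * (t - s)" using eq by (simp add: algebra_simps)
    ultimately have "a = b" using incongruentD[OF T(2) a] by blast
    then show "a = b \<and> s = t" using eq g(2) by simp
  qed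
  moreover have "digit_sums T g (Suc m) = (\<lambda>(a, s). a + g * s) ` (T \<times> ?S)" by force
  ultimately show ?case using Suc by (simp add: card_image card_cartesian_product)
qed simp

lemma base_le_if_power_le:
  fixes t :: nat
  assumes "\<And>m. t ^ m \<le> E * C ^ m" shows "t \<le> C"
proof (rule ccontr)
  assume "\<not> t \<le> C"
  then have t: "C < t" by simp
  have "C > 0" using assms[of 1] t by (cases C) auto
  then have "1 < real t / real C" using t by simp
  then obtain m where "real E < (real t / real C) ^ m" using real_arch_pow by blast
  then have "real (E * C ^ m) < real (t ^ m)" using \<open>C > 0\<close> by (simp add: power_divide field_simps)
  then have "E * C ^ m < t ^ m" by (simp only: of_nat_less_iff)
  then show False using assms[of m] by simp
qed

lemma card_le_digit_growth:
  fixes R :: "'f::field set"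
  assumes "subring R fring" "g \<in> R" "g \<noteq> 0" "T \<subseteq> R" "incongruent ((*) g ` R) T"
    and "\<And>m. card (digit_sums T g m) \<le> E * C ^ m"
  shows "card T \<le> C"
proof (rule base_le_if_power_le)
  show "card T ^ m \<le> E * C ^ m" for m
    using assms(6)[of m] card_digit_sums_incongruent[OF assms(1-5)] by simp
qed

lemma index_le_digit_growth:
  fixes R :: "'f::field set"
  assumes "digit_growth_le g C" "subring R fring" "g \<in> R" "g \<noteq> 0"
  shows "index_le ((*) g ` R) R C"
  unfolding index_le_def
proof (intro allI impI)
  fix T assume T: "T \<subseteq> R" "finite T" "incongruent ((*) g ` R) T"
  obtain E where "\<And>m. card (digit_sums T g m) \<le> E * C ^ m"
    using assms(1) T(2) unfolding digit_growth_le_def by blast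
  then show "card T \<le> C" by (rule card_le_digit_growth[OF assms(2-4) T(1,3)])
qed

definition shift_le :: "(nat \<Rightarrow> 'f::field set) \<Rightarrow> 'f \<Rightarrow> nat \<Rightarrow> bool" where
  "shift_le A f e \<longleftrightarrow> (\<forall>d. \<forall>a\<in>A d. f * a \<in> A (d + e))"

lemma shift_leD: "shift_le A f e \<Longrightarrow> a \<in> A d \<Longrightarrow> f * a \<in> A (d + e)"
  by (simp add: shift_le_def)

lemma shift_le_power:
  assumes "shift_le A f e" shows "shift_le A (f ^ n) (n * e)"
proof (induction n)
  case (Suc n)
  show ?case unfolding shift_le_def
  proof (intro allI ballI)
    fix d a assume "a \<in> A d"
    then have "f * (f ^ n * a) \<in> A ((d + n * e) + e)"
      by (intro shift_leD[OF assms] shift_leD[OF Suc])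
    moreover have "d + n * e + e = d + Suc n * e" by simp
    ultimately show "f ^ Suc n * a \<in> A (d + Suc n * e)" by (simp only: power_Suc mult.assoc)
  qed
qed (simp add: shift_le_def)

text \<open>
  If \<open>h\<close> is a common denominator of \<open>1\<close> and \<open>g\<close>, one factor \<open>h\<close> per digit carries all sums of \<open>m\<close>
  digits into the filtration, at a cost \<open>D\<close> per digit that depends on \<open>g\<close> but not on the digits.
\<close>

lemma shift_digit_sums:
  fixes A :: "nat \<Rightarrow> 'f::field set"
  assumes A_zero: "\<And>d. 0 \<in> A d" and A_add: "\<And>d a b. a \<in> A d \<Longrightarrow> b \<in> A d \<Longrightarrow> a + b \<in> A d"
    and h: "shift_le A h D" "shift_le A (h * g) D" and b: "\<And>f. f \<in> T \<Longrightarrow> shift_le A (b * f) e"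
    and w: "w \<in> A k"
  shows "s \<in> digit_sums T g m \<Longrightarrow> b * h ^ m * w * s \<in> A (k + e + m * D)"
proof (induction m arbitrary: s)
  case 0
  then show ?case by (simp add: A_zero)
next
  case (Suc m)
  then obtain a s' where s: "s = a + g * s'" "a \<in> T" "s' \<in> digit_sums T g m" by auto
  have "h ^ Suc m * (b * a * w) \<in> A (k + e + Suc m * D)"
    by (intro shift_leD[OF shift_le_power[OF h(1)]] shift_leD[OF b] s(2) w)
  moreover have "h * g * (b * h ^ m * w * s') \<in> A (k + e + m * D + D)"
    by (rule shift_leD[OF h(2) Suc.IH[OF s(3)]])
  moreover have "b * h ^ Suc m * w * s = h ^ Suc m * (b * a * w) + h * g * (b * h ^ m * w * s')"
    by (simp add: s(1) algebra_simps)
  ultimately show ?case using A_add by (simp add: algebra_simps)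
qed

lemma digit_growth_filtration:
  fixes A :: "nat \<Rightarrow> 'f::field set" and g :: 'f
  assumes A_zero: "\<And>d. 0 \<in> A d" and A_add: "\<And>d a b. a \<in> A d \<Longrightarrow> b \<in> A d \<Longrightarrow> a + b \<in> A d"
    and A_card: "\<And>d. finite (A d) \<and> card (A d) \<le> q ^ d"
    and denominator: "\<And>T. finite T \<Longrightarrow> \<exists>b e. b \<noteq> 0 \<and> (\<forall>f\<in>T. shift_le A (b * f) e)"
    and w: "w \<in> A k" "w \<noteq> 0"
  shows "\<exists>C. digit_growth_le g C"
proof -
  obtain h D where h: "h \<noteq> 0" "shift_le A h D" "shift_le A (h * g) D"
    using denominator[of "{1, g}"] by auto
  have "\<exists>E. \<forall>m. card (digit_sums T g m) \<le> E * (q ^ D) ^ m" if T: "finite T" for T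
  proof -
    obtain b e where b: "b \<noteq> 0" "\<And>f. f \<in> T \<Longrightarrow> shift_le A (b * f) e"
      using denominator[OF T] by blast
    note shifted = shift_digit_sums[OF A_zero A_add h(2,3) b(2) w(1)]
    have "card (digit_sums T g m) \<le> q ^ (k + e) * (q ^ D) ^ m" for m
    proof -
      have "inj_on ((*) (b * h ^ m * w)) (digit_sums T g m)"
        using b(1) h(1) w(2) by (auto simp: inj_on_def)
      then have "card (digit_sums T g m) \<le> card (A (k + e + m * D))"
        using shifted A_card by (intro card_inj_on_le) auto
      also have "\<dots> \<le> q ^ (k + e + m * D)" using A_card by blast
      finally show ?thesis by (simp add: power_add power_mult mult.commute)
    qed
    then show ?thesis by blast
  qed
  then show ?thesis unfolding digit_growth_le_def by blast
qed

text \<open>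
  The polynomials of degree less than \<open>d\<close> in \<open>x\<close> are \<open>digit_sums R x d\<close>; a common denominator
  moves finitely many functions into the module of vectors of such polynomials.
\<close>

context
  fixes R :: "'f::field set" and x :: 'f and us :: "'f list"
  assumes R: "subring R fring"
begin

definition poly_span :: "nat \<Rightarrow> 'f set" where
  "poly_span d = fring.Span (digit_sums R x d) us"

lemma poly_span_zero: "0 \<in> poly_span d"
  unfolding poly_span_def by (intro Span_fring_zero digit_sums_zero[OF R])

lemma poly_span_add: "a \<in> poly_span d \<Longrightarrow> b \<in> poly_span d \<Longrightarrow> a + b \<in> poly_span d"
  unfolding poly_span_def by (rule Span_fring_add[OF digit_sums_add[OF R]])

lemma poly_span_mono: "d \<le> e \<Longrightarrow> poly_span d \<subseteq> poly_span e"
  unfolding poly_span_def by (intro Span_fring_mono digit_sums_mono[OF R])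

lemma poly_span_mult: "p \<in> digit_sums R x c \<Longrightarrow> a \<in> poly_span d \<Longrightarrow> p * a \<in> poly_span (c + d)"
  unfolding poly_span_def by (rule Span_fring_mult[OF digit_sums_mult[OF R]])

lemma shift_le_poly_span:
  assumes "\<And>u. u \<in> set us \<Longrightarrow> f * u \<in> poly_span e"
  shows "shift_le poly_span f e"
  unfolding shift_le_def
proof (intro allI ballI)
  fix d a assume "a \<in> poly_span d"
  have "f * a \<in> poly_span (d + e)"
    if "a \<in> fring.Span (digit_sums R x d) vs" "set vs \<subseteq> set us" for vs
    using that
  proof (induction vs arbitrary: a)
    case (Cons v vs)
    then obtain p s where a: "a = p * v + s" "p \<in> digit_sums R x d" and "f * s \<in> poly_span (d + e)"
      by auto
    moreover have "p * (f * v) \<in> poly_span (d + e)"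
      using poly_span_mult[OF a(2) assms] Cons.prems(2) by simp
    moreover have "f * a = p * (f * v) + f * s" by (simp add: a(1) algebra_simps)
    ultimately show ?case using poly_span_add by simp
  qed (simp add: poly_span_zero)
  then show "f * a \<in> poly_span (d + e)" using \<open>a \<in> poly_span d\<close> unfolding poly_span_def by blast
qed

context
  assumes spanning: "fring.Span (fractions (fring.simple_extension R x)) us = UNIV"
begin

lemma clear_denominator: "\<exists>c d. \<exists>b\<in>digit_sums R x c. b \<noteq> 0 \<and> b * f \<in> poly_span d"
proof -
  let ?L = "fractions (fring.simple_extension R x)"
  have "\<exists>c d. \<exists>b\<in>digit_sums R x c. b \<noteq> 0 \<and> b * f \<in> fring.Span (digit_sums R x d) vs"
    if "f \<in> fring.Span ?L vs" for vs
    using that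
  proof (induction vs arbitrary: f)
    case Nil
    have "1 \<in> digit_sums R x 1" using subring_fringD(2)[OF R] by simp
    then show ?case using Nil by (auto intro!: exI[of _ 1] bexI[of _ 1])
  next
    case (Cons v vs)
    then obtain l s where f: "f = l * v + s" "l \<in> ?L" "s \<in> fring.Span ?L vs" by auto
    obtain b c d where b: "b \<in> digit_sums R x c" "b \<noteq> 0" "b * l \<in> digit_sums R x d"
      using f(2) unfolding fractions_def simple_extension_eq_digit_sums[OF R] by auto
    obtain b' c' d' where b': "b' \<in> digit_sums R x c'" "b' \<noteq> 0"
      "b' * s \<in> fring.Span (digit_sums R x d') vs" using Cons.IH[OF f(3)] by blast
    let ?e = "c' + d + (c + d')"
    have "b' * (b * l) \<in> digit_sums R x ?e"
      using digit_sums_mult[OF R b'(1) b(3)] digit_sums_mono[OF R, of "c' + d" ?e] by auto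
    moreover have "b * (b' * s) \<in> fring.Span (digit_sums R x (c + d')) vs"
      by (rule Span_fring_mult[OF digit_sums_mult[OF R b(1)] b'(3)])
    then have "b * (b' * s) \<in> fring.Span (digit_sums R x ?e) vs"
      using Span_fring_mono[OF digit_sums_mono[OF R, of "c + d'" ?e]] by auto
    moreover have "b * b' * f = (b' * (b * l)) * v + b * (b' * s)"
      by (simp add: f(1) algebra_simps)
    ultimately have "b * b' * f \<in> fring.Span (digit_sums R x ?e) (v # vs)"
      using Span_fring_ConsI by metis
    moreover have "b * b' \<in> digit_sums R x (c + c')" by (rule digit_sums_mult[OF R b(1) b'(1)])
    ultimately show ?case using b(2) b'(2) by (metis mult_eq_0_iff)
  qed
  then show ?thesis using spanning unfolding poly_span_def by blast
qed

lemma clear_common_denominator: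
  assumes "finite T"
  shows "\<exists>c d. \<exists>b\<in>digit_sums R x c. b \<noteq> 0 \<and> (\<forall>f\<in>T. b * f \<in> poly_span d)"
  using assms
proof (induction T)
  case empty
  then show ?case using clear_denominator by blast
next
  case (insert f T)
  then obtain b c d where b: "b \<in> digit_sums R x c" "b \<noteq> 0" "\<And>f. f \<in> T \<Longrightarrow> b * f \<in> poly_span d"
    by blast
  obtain b' c' d' where b': "b' \<in> digit_sums R x c'" "b' \<noteq> 0" "b' * f \<in> poly_span d'"
    using clear_denominator by blast
  let ?e = "c' + d + (c + d')"
  have "b * b' * h \<in> poly_span ?e" if "h \<in> insert f T" for h
  proof (cases "h = f")
    case True
    then show ?thesis
      using poly_span_mult[OF b(1) b'(3)] poly_span_mono[of "c + d'" ?e] by (auto simp: mult.assoc)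
  next
    case False
    then show ?thesis
      using poly_span_mult[OF b'(1) b(3)] poly_span_mono[of "c' + d" ?e] that
      by (auto simp: mult.left_commute mult.assoc)
  qed
  moreover have "b * b' \<in> digit_sums R x (c + c')" by (rule digit_sums_mult[OF R b(1) b'(1)])
  ultimately show ?case using b(2) b'(2) by (metis mult_eq_0_iff)
qed

lemma denominator_shift_le:
  assumes "finite T"
  shows "\<exists>b e. b \<noteq> 0 \<and> (\<forall>f\<in>T. shift_le poly_span (b * f) e)"
proof -
  have "finite ((\<lambda>(f, u). f * u) ` (T \<times> set us))" using assms by simp
  from clear_common_denominator[OF this] obtain b d where
    b: "b \<noteq> 0" "\<And>f u. f \<in> T \<Longrightarrow> u \<in> set us \<Longrightarrow> b * (f * u) \<in> poly_span d" by auto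
  then have "shift_le poly_span (b * f) d" if "f \<in> T" for f
    using that by (intro shift_le_poly_span) (simp add: mult.assoc)
  then show ?thesis using b(1) by blast
qed

lemma digit_growth_spanning:
  fixes g :: 'f
  assumes "finite R"
  shows "\<exists>C. digit_growth_le g C"
proof -
  obtain b k where b: "b \<noteq> 0" "b * 1 \<in> poly_span k" using clear_denominator[of 1] by blast
  show ?thesis
  proof (rule digit_growth_filtration[OF poly_span_zero poly_span_add _ denominator_shift_le])
    show "finite (poly_span d) \<and> card (poly_span d) \<le> (card R ^ length us) ^ d" for d
    proof -
      note P = card_digit_sums_le[OF assms, of x d]
      note span = card_Span_fring_le[of "digit_sums R x d" us]
      have "card (poly_span d) \<le> card (digit_sums R x d) ^ length us"
        unfolding poly_span_def using P span by blast
      also have "\<dots> \<le> (card R ^ d) ^ length us" using P by (intro power_mono) auto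
      finally show ?thesis
        unfolding poly_span_def using P span by (simp add: mult.commute flip: power_mult)
    qed
  qed (use b in auto)
qed

end

end

lemma (in finite_field_curve) ex_digit_growth: "\<exists>C. digit_growth_le (g :: 'f) C"
proof -
  obtain x :: 'f where "fring.finite_dimension (generate_field fring (insert x K)) UNIV"
    using function_field by auto
  then obtain n where "fring.dimension n (generate_field fring (insert x K)) UNIV" by auto
  moreover have "subfield (generate_field fring (insert x K)) fring"
    by (intro field.generate_field_is_subfield[OF field_from_type_algebra]) simp
  ultimately obtain us where us: "fring.Span (generate_field fring (insert x K)) us = UNIV"
    using fring.exists_base by blast
  have K: "subring K fring" using subfieldE(1)[OF subfield_K] .
  have ext: "subring (fring.simple_extension K x) fring"
    by (intro fring.simple_extension_is_subring K) simp
  have "insert x K \<subseteq> fring.simple_extension K x"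
    using fring.simple_extension_incl[of K x] fring.simple_extension_mem[OF K, of x] by simp
  then have "insert x K \<subseteq> fractions (fring.simple_extension K x)"
    using subset_fractions[OF ext] by blast
  then have "generate_field fring (insert x K) \<subseteq> fractions (fring.simple_extension K x)"
    by (intro field.generate_field_min_subfield1[OF field_from_type_algebra]
        subfield_fractions[OF ext]) simp_all
  then have "fring.Span (fractions (fring.simple_extension K x)) us = UNIV"
    using Span_fring_mono us by blast
  then show ?thesis by (rule digit_growth_spanning[OF K _ finite_K])
qed

section \<open>Valuation rings\<close>

lemma maximal_subring_exists:
  fixes R0 :: "'f::field set"
  assumes "subring R0 fring" and "y \<notin> R0"
  shows "\<exists>R. subring R fring \<and> R0 \<subseteq> R \<and> y \<notin> R \<and>
    (\<forall>R'. subring R' fring \<longrightarrow> R \<subseteq> R' \<longrightarrow> y \<notin> R' \<longrightarrow> R' = R)"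
proof -
  let ?A = "{R. subring R fring \<and> R0 \<subseteq> R \<and> y \<notin> R}"
  have "\<exists>M\<in>?A. \<forall>R\<in>?A. M \<subseteq> R \<longrightarrow> R = M"
  proof (rule subset_Zorn_nonempty)
    show "?A \<noteq> {}" using assms by auto
    fix Ch assume Ch: "Ch \<noteq> {}" "subset.chain ?A Ch"
    then have mem: "\<And>R. R \<in> Ch \<Longrightarrow> subring R fring \<and> R0 \<subseteq> R \<and> y \<notin> R"
      and chain: "\<And>R R'. R \<in> Ch \<Longrightarrow> R' \<in> Ch \<Longrightarrow> R \<subseteq> R' \<or> R' \<subseteq> R"
      by (auto simp: subset_chain_def)
    have "subring (\<Union>Ch) fring"
    proof (rule subring_fringI)
      show "1 \<in> \<Union>Ch" using Ch(1) mem subring_fringD(2) by blast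
      fix a b assume "a \<in> \<Union>Ch" "b \<in> \<Union>Ch"
      then obtain R where "R \<in> Ch" "a \<in> R" "b \<in> R" using chain by blast
      then show "a - b \<in> \<Union>Ch" "a * b \<in> \<Union>Ch" using mem subring_fringD(5,6) by blast+
    qed
    then show "\<Union>Ch \<in> ?A" using Ch(1) mem by blast
  qed
  then obtain M where "M \<in> ?A" and max: "\<forall>R\<in>?A. M \<subseteq> R \<longrightarrow> R = M" by (rule bexE)
  then have M: "subring M fring" "R0 \<subseteq> M" "y \<notin> M" by simp_all
  show ?thesis
  proof (intro exI[of _ M] conjI allI impI M)
    fix R assume R: "subring R fring" "M \<subseteq> R" "y \<notin> R"
    then have "R \<in> ?A" using order_trans[OF M(2) R(2)] by simp
    then show "R = M" using max R(2) by (simp only: Ball_def)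
  qed
qed

context
  fixes V :: "'f::field set" and z :: 'f
  assumes V: "subring V fring" and z: "z \<in> V" "inverse z \<notin> V"
begin

text \<open>
  Two relations \<open>1/z = a\<^sub>0 + \<dots> + a\<^sub>n u\<^sup>n\<close> and
  \<open>1/z = b\<^sub>0 + \<dots> + b\<^sub>m u\<^sup>-\<^sup>m\<close> with \<open>m \<le> n\<close> combine to
  one of degree less than \<open>n\<close> in \<open>u\<close>: the second makes \<open>(1 - z b\<^sub>0) u\<^sup>n\<close> a multiple of
  \<open>z\<close> by a polynomial of lower degree.
\<close>

lemma inverse_digit_sums_lower_degree:
  assumes u: "u \<noteq> 0" and "m \<le> n"
    and pos: "inverse z \<in> digit_sums V u (Suc n)"
      and neg: "inverse z \<in> digit_sums V (inverse u) (Suc m)"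
  shows "inverse z \<in> digit_sums V u n"
proof -
  have z0: "z \<noteq> 0" using z by auto
  obtain b s where b: "inverse z = b + inverse u * s" "b \<in> V" "s \<in> digit_sums V (inverse u) m"
    using neg by auto
  obtain a t where a: "inverse z = t + a * u ^ n" "a \<in> V" "t \<in> digit_sums V u n"
    using pos unfolding digit_sums_Suc_top by auto
  have "n > 0"
  proof (rule ccontr)
    assume "\<not> n > 0"
    then have "inverse z = b" using b(1,3) \<open>m \<le> n\<close> by simp
    then show False using b(2) z(2) by simp
  qed
  then have "b \<in> digit_sums V u n"
    using digit_sums_mono[OF V, of 1 n u] b(2) by auto
  moreover have "z * a \<in> V" "1 - z * b \<in> V"
    using subring_fringD(2,5,6)[OF V] z(1) a(2) b(2) by blast+
  then have "(1 - z * b) * t \<in> digit_sums V u n" "z * a * (u ^ n * (inverse u * s)) \<in> digit_sums V u n"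
    using digit_sums_scale[OF V] digit_sums_reverse[OF V u b(3) \<open>m \<le> n\<close>] a(3) by blast+
  moreover have "inverse z = b + ((1 - z * b) * t + z * a * (u ^ n * (inverse u * s)))"
  proof -
    have "inverse u * s = (1 - z * b) * inverse z" using b(1) z0 by (simp add: field_simps)
    then have s: "z * a * (u ^ n * (inverse u * s)) = (1 - z * b) * (a * u ^ n)" using z0 by simp
    have "inverse z = b + (1 - z * b) * inverse z" using z0 by (simp add: field_simps)
    also have "\<dots> = b + (1 - z * b) * (t + a * u ^ n)" by (simp only: a(1))
    also have "\<dots> = b + ((1 - z * b) * t + z * a * (u ^ n * (inverse u * s)))"
      by (simp only: s distrib_left)
    finally show ?thesis .
  qed
  ultimately show ?thesis using digit_sums_add[OF V] by metis
qed

lemma inverse_not_in_both_digit_sums: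
  assumes "u \<noteq> 0"
  shows "inverse z \<notin> digit_sums V u n \<or> inverse z \<notin> digit_sums V (inverse u) m"
proof (induction "n + m" arbitrary: n m rule: less_induct)
  case less
  show ?case
  proof (rule ccontr)
    assume "\<not> ?case"
    then have both: "inverse z \<in> digit_sums V u n" "inverse z \<in> digit_sums V (inverse u) m"
      by blast+
    have "inverse z \<noteq> 0" using z(2) subring_fringD(1)[OF V] by auto
    then obtain k l where kl: "n = Suc k" "m = Suc l" using both by (cases n; cases m) auto
    show False
    proof (cases "l \<le> k")
      case True
      then show False
        using inverse_digit_sums_lower_degree[OF assms True] both less.hyps[of k m] kl by auto
    next
      case False
      then have "inverse z \<in> digit_sums V (inverse u) l"
        using inverse_digit_sums_lower_degree[of "inverse u" k l] both assms kl by simp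
      then show False using less.hyps[of n l] both(1) kl by auto
    qed
  qed
qed

lemma maximal_subring_valuation:
  assumes max: "\<And>R. subring R fring \<Longrightarrow> V \<subseteq> R \<Longrightarrow> inverse z \<notin> R \<Longrightarrow> R = V"
  shows "u \<in> V \<or> inverse u \<in> V"
proof (rule ccontr)
  assume notin: "\<not> (u \<in> V \<or> inverse u \<in> V)"
  then have "u \<noteq> 0" using subring_fringD(1)[OF V] by auto
  have "\<exists>n. inverse z \<in> digit_sums V w n" if "w \<notin> V" for w
  proof -
    have "subring (fring.simple_extension V w) fring"
      by (intro fring.simple_extension_is_subring V) simp
    moreover have "V \<subseteq> fring.simple_extension V w" "w \<in> fring.simple_extension V w"
      using fring.simple_extension_incl[of V w] fring.simple_extension_mem[OF V, of w] by simp_all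
    ultimately have "inverse z \<in> fring.simple_extension V w" using max that by blast
    then show ?thesis using simple_extension_eq_digit_sums[OF V] by blast
  qed
  then show False using notin inverse_not_in_both_digit_sums[OF \<open>u \<noteq> 0\<close>] by blast
qed

end

locale valuation_subring =
  fixes V :: "'f::field set"
  assumes subring_V: "subring V fring" and valuation: "u \<in> V \<or> inverse u \<in> V"
begin

lemmas in_V = subring_fringD[OF subring_V]

definition units :: "'f set" where
  "units = {u \<in> V. u \<noteq> 0 \<and> inverse u \<in> V}"

definition nonunits :: "'f set" where
  "nonunits = V - units"

lemma units_mult: "a \<in> units \<Longrightarrow> b \<in> units \<Longrightarrow> a * b \<in> units"
  using in_V(6) by (auto simp: units_def)

lemma units_inverse: "a \<in> units \<Longrightarrow> inverse a \<in> units"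
  by (auto simp: units_def)

lemma nonunits_mult:
  assumes "r \<in> V" "x \<in> nonunits" shows "r * x \<in> nonunits"
proof -
  have "x \<in> units" if "r * x \<in> units"
  proof -
    have "inverse x = r * inverse (r * x)" using that by (auto simp: units_def)
    moreover have "inverse (r * x) \<in> V" using that unfolding units_def by blast
    ultimately have "inverse x \<in> V" using in_V(6) assms(1) by metis
    then show ?thesis using that assms(2) by (auto simp: units_def nonunits_def)
  qed
  then show ?thesis using assms in_V(6) by (auto simp: nonunits_def)
qed

lemma nonunits_add:
  assumes "x \<in> nonunits" "y \<in> nonunits" shows "x + y \<in> nonunits"
proof -
  have add: "a + b \<in> nonunits" if "a \<in> nonunits" "b \<in> nonunits" "b \<noteq> 0" "a / b \<in> V" for a b
  proof -
    have "a + b = (a / b + 1) * b" using that(3) by (simp add: field_simps)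
    moreover have "a / b + 1 \<in> V" using in_V(2,4) that(4) by simp
    ultimately show ?thesis using nonunits_mult that(2) by metis
  qed
  consider "x = 0 \<or> y = 0" | "x \<noteq> 0" "y \<noteq> 0" "x / y \<in> V" | "x \<noteq> 0" "y \<noteq> 0" "y / x \<in> V"
    using valuation[of "x / y"] by auto
  then show ?thesis
  proof cases
    case 1
    then show ?thesis using assms by auto
  next
    case 2
    then show ?thesis using add assms by (metis DiffD1 DiffI singletonD zero_fring)
  next
    case 3
    then show ?thesis using add[of y x] assms by (simp add: add.commute)
  qed
qed

lemma nonunits_diff: "x \<in> nonunits \<Longrightarrow> y \<in> nonunits \<Longrightarrow> x - y \<in> nonunits"
  using nonunits_add[of x "-1 * y"] nonunits_mult[of "-1" y] in_V(2,3) by simp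

lemma one_notin_nonunits: "1 \<notin> nonunits"
  using in_V(2) by (simp add: nonunits_def units_def)

lemma nonunits_power:
  assumes "t \<in> nonunits" "n > 0" shows "t ^ n \<in> nonunits"
proof -
  have "t ^ (n - 1) \<in> V" using assms(1) in_V(7) by (simp add: nonunits_def)
  from nonunits_mult[OF this assms(1)] show ?thesis using assms(2) by (simp flip: power_Suc2)
qed

lemma finite_common_divisor:
  assumes "finite M" "M \<noteq> {}" "0 \<notin> M"
  shows "\<exists>t\<in>M. \<forall>a\<in>M. a / t \<in> V"
  using assms
proof (induction M rule: finite_ne_induct)
  case (singleton x)
  then show ?case using in_V(2) by simp
next
  case (insert x M)
  then obtain t where t: "t \<in> M" "\<forall>a\<in>M. a / t \<in> V" by auto
  have nz: "t \<noteq> 0" "x \<noteq> 0" using insert.prems t by auto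
  show ?case
  proof (cases "x / t \<in> V")
    case True
    then show ?thesis using t by auto
  next
    case False
    then have tx: "t / x \<in> V" using valuation[of "x / t"] by simp
    have "a / x \<in> V" if "a \<in> M" for a
    proof -
      have "a / x = (a / t) * (t / x)" using nz by simp
      then show ?thesis using t(2) tx that in_V(6) by metis
    qed
    then show ?thesis using in_V(2) nz by auto
  qed
qed

lemma uniformizer_exists:
  assumes z: "z \<in> nonunits" "z \<noteq> 0" and index: "index_le ((*) z ` V) V C"
  shows "\<exists>t\<in>nonunits. t \<noteq> 0 \<and> (\<forall>w\<in>nonunits. w / t \<in> V)"
proof -
  have "z * a - z * b \<in> (*) z ` V" if "a \<in> V" "b \<in> V" for a b
    using in_V(5)[OF that] by (metis imageI right_diff_distrib)
  then have "\<exists>T. residue_system ((*) z ` V) V T"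
    using in_V(1) by (intro residue_system_exists[OF _ _ index]) auto
  then obtain T where T: "finite T" "\<And>w. w \<in> V \<Longrightarrow> \<exists>a\<in>T. w - a \<in> (*) z ` V"
    unfolding residue_system_def by metis
  let ?M = "insert z (T \<inter> nonunits - {0})"
  have "\<exists>t\<in>?M. \<forall>a\<in>?M. a / t \<in> V" by (rule finite_common_divisor) (use T(1) z in auto)
  then obtain t where t: "t \<in> ?M" "\<And>a. a \<in> ?M \<Longrightarrow> a / t \<in> V" by blast
  have "w / t \<in> V" if w: "w \<in> nonunits" for w
  proof -
    obtain a r where a: "a \<in> T" "r \<in> V" "w - a = z * r"
      using T(2)[of w] w unfolding nonunits_def by blast
    have "a = w - r * z" using a(3) by (simp add: algebra_simps)
    then have "a \<in> nonunits" using nonunits_diff nonunits_mult[OF a(2) z(1)] w by simp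
    then have "a / t \<in> V" using a(1) t(2) in_V(1) by (cases "a = 0") auto
    moreover have "(z / t) * r \<in> V" using t(2)[of z] a(2) in_V(6) by blast
    moreover have "w / t = a / t + (z / t) * r"
      using a(3) by (simp add: field_simps flip: add_divide_distrib)
    ultimately show ?thesis using in_V(4) by metis
  qed
  then show ?thesis using t(1) z by auto
qed

lemma power_divides_bounded:
  assumes t: "t \<in> nonunits" "t \<noteq> 0" and index: "index_le ((*) w ` V) V C"
  shows "\<exists>k. w / t ^ k \<notin> V"
proof (rule ccontr)
  assume "\<not> ?thesis"
  then have divisible: "w / t ^ k \<in> V" for k by simp
  have less: "t ^ i - t ^ j \<noteq> w * r" if "i < j" "r \<in> V" for i j r
  proof
    assume eq: "t ^ i - t ^ j = w * r"
    have "t ^ i * (1 - t ^ (j - i)) = w * r"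
      using eq that(1) by (simp add: right_diff_distrib flip: power_add)
    also have "\<dots> = t ^ i * (w / t ^ Suc i * r * t)" using t(2) by simp
    finally have "1 - t ^ (j - i) = w / t ^ Suc i * r * t"
      using t(2) by (simp only: mult_cancel_left power_eq_0_iff) simp
    moreover have "w / t ^ Suc i * r * t \<in> nonunits"
      using nonunits_mult[OF in_V(6)[OF divisible that(2)] t(1)] .
    ultimately have "(1 - t ^ (j - i)) + t ^ (j - i) \<in> nonunits"
      using nonunits_add nonunits_power[OF t(1), of "j - i"] that(1) by simp
    then show False using one_notin_nonunits by simp
  qed
  have distinct: "i = j" if "t ^ i - t ^ j = w * r" "r \<in> V" for i j r
  proof (rule ccontr)
    assume "i \<noteq> j"
    moreover have "t ^ j - t ^ i = w * - r" using that(1) by (simp add: algebra_simps)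
    ultimately show False using less[of i j r] less[of j i "- r"] that in_V(3)
      by (meson linorder_neqE_nat)
  qed
  let ?T = "(^) t ` {..C}"
  have "inj ((^) t)" using distinct[of _ _ 0] in_V(1) by (intro injI) simp
  then have "card ?T = Suc C" by (simp add: card_image inj_on_subset)
  moreover have "incongruent ((*) w ` V) ?T" using distinct unfolding incongruent_def by blast
  moreover have "?T \<subseteq> V" using t(1) in_V(7) by (auto simp: nonunits_def)
  ultimately show False using index_leD[OF index, of ?T] by simp
qed

end

locale discrete_valuation_subring = valuation_subring V for V :: "'f::field set" +
  fixes t :: 'f
  assumes nonunit_t: "t \<in> nonunits" and t_nz: "t \<noteq> 0"
    and t_divides: "w \<in> nonunits \<Longrightarrow> w / t \<in> V"
    and t_powers_bounded: "w \<noteq> 0 \<Longrightarrow> w \<in> V \<Longrightarrow> \<exists>k. w / t ^ k \<notin> V"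
begin

lemma power_t_in_V: "t ^ n \<in> V"
  using nonunit_t in_V(7) by (simp add: nonunits_def)

lemma powi_unit:
  assumes "t powi k \<in> units" shows "k = 0"
proof (rule ccontr)
  assume "k \<noteq> 0"
  then have "t ^ nat \<bar>k\<bar> \<notin> units"
    using nonunits_power[OF nonunit_t, of "nat \<bar>k\<bar>"] by (simp add: nonunits_def)
  moreover have "t ^ nat \<bar>k\<bar> \<in> units"
    using assms units_inverse[OF assms] by (cases "k \<ge> 0") (auto simp: power_int_def power_inverse)
  ultimately show False by simp
qed

lemma ex_unit_times_power:
  assumes "f \<in> V" "f \<noteq> 0" shows "\<exists>j. f / t ^ j \<in> units"
proof -
  let ?k = "LEAST k. f / t ^ k \<notin> V"
  have k: "f / t ^ ?k \<notin> V" using t_powers_bounded[OF assms(2,1)] by (rule LeastI_ex)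
  then obtain j where j: "?k = Suc j" using assms(1) by (cases ?k) auto
  then have "f / t ^ j \<in> V" using not_less_Least[of j "\<lambda>k. f / t ^ k \<notin> V"] by auto
  moreover have "f / t ^ j \<notin> nonunits"
    using k j t_divides[of "f / t ^ j"] by (auto simp: mult.commute)
  ultimately show ?thesis by (auto simp: nonunits_def)
qed

lemma ex_unit_times_powi:
  assumes "f \<noteq> 0" shows "\<exists>k. f / t powi k \<in> units"
proof (cases "f \<in> V")
  case True
  then obtain j where "f / t ^ j \<in> units" using ex_unit_times_power assms by blast
  then show ?thesis by (intro exI[of _ "int j"]) simp
next
  case False
  then have "inverse f \<in> V" "inverse f \<noteq> 0" using valuation[of f] assms by auto
  then obtain j where "inverse f / t ^ j \<in> units" using ex_unit_times_power by blast
  from units_inverse[OF this] show ?thesis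
    by (intro exI[of _ "- int j"]) (simp add: power_int_minus field_simps)
qed

definition val :: "'f \<Rightarrow> int" where
  "val f = (if f = 0 then 0 else (THE k. f / t powi k \<in> units))"

lemma val_eqI:
  assumes "f \<noteq> 0" "f / t powi k \<in> units" shows "val f = k"
proof -
  have "l = k" if "f / t powi l \<in> units" for l
  proof -
    have "(f / t powi k) * inverse (f / t powi l) = t powi (l - k)"
      using assms(1) t_nz by (simp add: power_int_diff field_simps)
    then have "t powi (l - k) \<in> units" using assms(2) that units_mult units_inverse by metis
    then show ?thesis using powi_unit by fastforce
  qed
  with assms(2) have "(THE k. f / t powi k \<in> units) = k" by (rule the_equality)
  then show ?thesis using assms(1) by (simp add: val_def)
qed

lemma val_unit: "f \<noteq> 0 \<Longrightarrow> f / t powi (val f) \<in> units"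
  using ex_unit_times_powi val_eqI by metis

lemma val_mult: assumes "f \<noteq> 0" "g \<noteq> 0" shows "val (f * g) = val f + val g"
proof (rule val_eqI)
  have "f * g / t powi (val f + val g) = (f / t powi val f) * (g / t powi val g)"
    using t_nz by (simp add: power_int_add)
  then show "f * g / t powi (val f + val g) \<in> units" using assms val_unit units_mult by metis
qed (use assms in auto)

lemma val_powi: "val (t powi k) = k"
  using t_nz in_V(2) by (intro val_eqI) (auto simp: units_def)

lemma val_pos: assumes "h \<in> nonunits" "h \<noteq> 0" shows "val h > 0"
proof (rule ccontr)
  assume "\<not> ?thesis"
  then have "h / t powi (val h) = t ^ nat (- val h) * h"
    by (simp add: power_int_def field_simps)
  then have "h / t powi (val h) \<in> nonunits" using nonunits_mult[OF power_t_in_V assms(1)] by simp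
  then show False using val_unit[OF assms(2)] by (simp add: nonunits_def)
qed

lemma val_nonneg: assumes "h \<in> V" "h \<noteq> 0" shows "val h \<ge> 0"
proof (cases "h \<in> nonunits")
  case True
  then show ?thesis using val_pos assms by force
next
  case False
  then have "val h = 0" using assms by (intro val_eqI) (auto simp: nonunits_def)
  then show ?thesis by simp
qed

lemma val_add_ge:
  assumes "f \<noteq> 0" "g \<noteq> 0" "f + g \<noteq> 0" "val f \<le> val g" shows "val f \<le> val (f + g)"
proof -
  let ?k = "val f"
  have "t powi (val g) = t ^ nat (val g - ?k) * t powi ?k"
    using t_nz assms(4) power_int_add[of t "val g - ?k" ?k] by (simp add: power_int_def)
  then have "(f + g) / t powi ?k = f / t powi ?k + (g / t powi (val g)) * t ^ nat (val g - ?k)"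
    using t_nz by (simp add: field_simps)
  moreover have "f / t powi ?k \<in> V" "g / t powi (val g) \<in> V"
    using val_unit[OF assms(1)] val_unit[OF assms(2)] by (auto simp only: units_def)
  ultimately have "(f + g) / t powi ?k \<in> V" using power_t_in_V in_V(4,6) by metis
  then have "0 \<le> val ((f + g) / t powi ?k)" using assms t_nz by (intro val_nonneg) auto
  moreover have "val (f + g) = val ((f + g) / t powi ?k) + ?k"
    using val_mult[of "(f + g) / t powi ?k" "t powi ?k"] assms t_nz val_powi by simp
  ultimately show ?thesis by simp
qed

lemma val_point:
  assumes "K \<subseteq> V" "\<And>c. c \<in> K \<Longrightarrow> inverse c \<in> K"
  shows "val \<in> points K"
  unfolding points_def mem_Collect_eq
proof (intro conjI allI impI ballI)
  show "val 0 = 0" by (simp add: val_def)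
  show "\<exists>x. x \<noteq> 0 \<and> val x = 1" using t_nz val_powi[of 1] by auto
  show "val (f * g) = val f + val g" if "f \<noteq> 0 \<and> g \<noteq> 0" for f g using val_mult that by auto
  show "min (val f) (val g) \<le> val (f + g)" if "f \<noteq> 0 \<and> g \<noteq> 0 \<and> f + g \<noteq> 0" for f g
    using val_add_ge[of f g] val_add_ge[of g f] that
    by (cases "val f \<le> val g") (auto simp: add.commute)
  show "val c = 0" if "c \<in> K" "c \<noteq> 0" for c
    using that assms by (intro val_eqI) (auto simp: units_def)
qed

end

context finite_field_curve
begin

lemma subring_K: "subring K fring"
  by (rule subfieldE(1)[OF subfield_K])

lemma inverse_in_K:
  assumes "c \<in> K" shows "inverse c \<in> K"
proof (cases "c = 0")
  case True
  then show ?thesis using assms by simp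
next
  case False
  then have "inv\<^bsub>fring\<^esub> c \<in> K"
    using fring.subfield_m_inv(1)[OF subfield_K, of c] assms
    by (metis DiffD1 DiffI singletonD zero_fring)
  then show ?thesis by (simp only: m_inv_fring[OF False])
qed

lemma inverse_in_simple_extension_K:
  assumes "inverse z \<in> fring.simple_extension K z" shows "z \<in> K"
proof (cases "z = 0")
  case True
  then show ?thesis using subring_fringD(1)[OF subring_K] by simp
next
  case False
  obtain p where p: "p \<in> carrier (univ_poly fring K)" "fring.eval p z = inverse z"
    using assms unfolding fring.simple_extension_as_eval_img[of K z, simplified] by force
  then have poly: "polynomial\<^bsub>fring\<^esub> K p" by (simp add: univ_poly_def)
  have "p \<noteq> []" using p(2) False by (cases p) simp_all
  moreover have "- 1 \<in> K" using subring_fringD(2,3)[OF subring_K] by blast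
  ultimately have "p @ [- 1] \<in> carrier (univ_poly fring K)"
    using poly by (simp add: univ_poly_def polynomial_def)
  moreover have "fring.eval (p @ [- 1]) z = 0"
    using p(2) False fring.eval_append_aux[of p "- 1" z] by simp
  ultimately have "(fring.algebraic over K) z"
    using fring.algebraicI[of "p @ [- 1]" K z] by simp
  then show ?thesis unfolding over_def by (rule full_constants)
qed

lemma ex_point_pos:
  assumes "inverse z \<notin> K" shows "\<exists>P\<in>points K. 0 < P z"
proof -
  have "z \<notin> K" using assms inverse_in_K by blast
  then have z: "z \<noteq> 0" "z \<notin> K" using subring_fringD(1)[OF subring_K] by metis+
  have ext: "subring (fring.simple_extension K z) fring"
    by (intro fring.simple_extension_is_subring subring_K) simp
  have "inverse z \<notin> fring.simple_extension K z"
    using inverse_in_simple_extension_K z(2) by blast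
  from maximal_subring_exists[OF ext this]
  obtain V where sub: "subring V fring" "fring.simple_extension K z \<subseteq> V" "inverse z \<notin> V"
    and max: "\<And>R. subring R fring \<Longrightarrow> V \<subseteq> R \<Longrightarrow> inverse z \<notin> R \<Longrightarrow> R = V"
    by blast
  have "z \<in> fring.simple_extension K z" "K \<subseteq> fring.simple_extension K z"
    using fring.simple_extension_mem[OF subring_K, of z] fring.simple_extension_incl[of K z]
    by simp_all
  then have zV: "z \<in> V" "K \<subseteq> V" using sub(2) by blast+
  interpret valuation_subring V
    by (rule valuation_subring.intro[OF sub(1) maximal_subring_valuation[OF sub(1) zV(1) sub(3) max]])
  have index: "\<exists>C. index_le ((*) w ` V) V C" if "w \<in> V" "w \<noteq> 0" for w
    using ex_digit_growth[of w] index_le_digit_growth[OF _ subring_V that] by blast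
  have nonunit_z: "z \<in> nonunits" using zV(1) sub(3) by (simp add: nonunits_def units_def)
  obtain C where "index_le ((*) z ` V) V C" using index[OF zV(1) z(1)] ..
  from uniformizer_exists[OF nonunit_z z(1) this]
  obtain t where t: "t \<in> nonunits" "t \<noteq> 0" "\<And>w. w \<in> nonunits \<Longrightarrow> w / t \<in> V" by blast
  have bounded: "\<exists>k. w / t ^ k \<notin> V" if "w \<noteq> 0" "w \<in> V" for w
    using power_divides_bounded[OF t(1,2)] index[OF that(2,1)] by blast
  interpret discrete_valuation_subring V t
    by (rule discrete_valuation_subring.intro[OF valuation_subring_axioms
          discrete_valuation_subring_axioms.intro[OF t bounded]])
  have "val \<in> points K" by (rule val_point[OF zV(2) inverse_in_K])
  then show ?thesis using val_pos[OF nonunit_z z(1)] by blast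
qed

end

section \<open>Points and weak approximation\<close>

definition ord_ge :: "'f::field point \<Rightarrow> int \<Rightarrow> 'f \<Rightarrow> bool" where
  "ord_ge v k f \<longleftrightarrow> f = 0 \<or> k \<le> v f"

lemma ord_ge_0 [simp]: "ord_ge v k 0"
  by (simp add: ord_ge_def)

lemma ord_ge_mono: "ord_ge v k f \<Longrightarrow> l \<le> k \<Longrightarrow> ord_ge v l f"
  by (auto simp: ord_ge_def)

context
  fixes v :: "'f::field point" and K :: "'f set"
  assumes v: "v \<in> points K"
begin

lemma point_mult: "f \<noteq> 0 \<Longrightarrow> g \<noteq> 0 \<Longrightarrow> v (f * g) = v f + v g"
  using v by (auto simp: points_def)

lemma point_const: "c \<in> K \<Longrightarrow> c \<noteq> 0 \<Longrightarrow> v c = 0"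
  using v by (auto simp: points_def)

lemma point_uniformizer: obtains t where "t \<noteq> 0" "v t = 1"
  using v by (auto simp: points_def)

lemma point_zero: "v 0 = 0"
  using v by (auto simp: points_def)

lemma point_one: "v 1 = 0"
  using point_mult[of 1 1] by simp

lemma point_uminus: "v (- f) = v f"
proof (cases "f = 0")
  case False
  have "v (-1) = 0" using point_mult[of "-1" "-1"] point_one by simp
  then show ?thesis using point_mult[of "-1" f] False by simp
qed simp

lemma point_inverse: "f \<noteq> 0 \<Longrightarrow> v (inverse f) = - v f"
  using point_mult[of f "inverse f"] point_one by simp

lemma point_divide: "f \<noteq> 0 \<Longrightarrow> g \<noteq> 0 \<Longrightarrow> v (f / g) = v f - v g"
  using point_mult[of f "inverse g"] point_inverse[of g] by (simp add: divide_inverse)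

lemma point_power: "f \<noteq> 0 \<Longrightarrow> v (f ^ n) = int n * v f"
  by (induction n) (auto simp: point_mult point_one algebra_simps)

lemma point_powi: "f \<noteq> 0 \<Longrightarrow> v (f powi k) = k * v f"
  by (auto simp: power_int_def point_power point_inverse)

lemma ord_ge_add: "ord_ge v k f \<Longrightarrow> ord_ge v k g \<Longrightarrow> ord_ge v k (f + g)"
proof -
  assume ge: "ord_ge v k f" "ord_ge v k g"
  have "min (v f) (v g) \<le> v (f + g)" if "f \<noteq> 0" "g \<noteq> 0" "f + g \<noteq> 0"
    using v that by (auto simp: points_def)
  then show ?thesis using ge unfolding ord_ge_def by fastforce
qed

lemma ord_ge_uminus: "ord_ge v k (- f) \<longleftrightarrow> ord_ge v k f"
  by (simp add: ord_ge_def point_uminus)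

lemma ord_ge_diff: "ord_ge v k f \<Longrightarrow> ord_ge v k g \<Longrightarrow> ord_ge v k (f - g)"
  using ord_ge_add[of k f "- g"] ord_ge_uminus[of k g] by simp

lemma ord_ge_mult: "ord_ge v k f \<Longrightarrow> ord_ge v l g \<Longrightarrow> ord_ge v (k + l) (f * g)"
  using point_mult[of f g] by (cases "f = 0 \<or> g = 0") (auto simp: ord_ge_def)

lemma ord_ge_mult_iff: "s \<noteq> 0 \<Longrightarrow> ord_ge v k (f * s) \<longleftrightarrow> ord_ge v (k - v s) f"
  using point_mult[of f s] by (cases "f = 0") (auto simp: ord_ge_def)

lemma ord_ge_sum: "(\<And>i. i \<in> I \<Longrightarrow> ord_ge v k (f i)) \<Longrightarrow> ord_ge v k (\<Sum>i\<in>I. f i)"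
  by (induction I rule: infinite_finite_induct) (auto intro: ord_ge_add)

lemma ord_ge_one: "ord_ge v k 1 \<longleftrightarrow> k \<le> 0"
  by (simp add: ord_ge_def point_one)

lemma point_add_dominant:
  assumes f: "f \<noteq> 0" and g: "ord_ge v (v f + 1) g"
  shows "f + g \<noteq> 0" "v (f + g) = v f"
proof -
  have "\<not> ord_ge v (v f + 1) (f + g)"
    using ord_ge_diff[of "v f + 1" "f + g" g] f g by (auto simp: ord_ge_def)
  moreover have "ord_ge v (v f) (f + g)"
    using f ord_ge_mono[OF g, of "v f"] by (intro ord_ge_add) (auto simp: ord_ge_def)
  ultimately show "f + g \<noteq> 0" "v (f + g) = v f" by (auto simp: ord_ge_def)
qed

lemma point_add_dominant_neg:
  assumes z: "z \<noteq> 0" and y: "y \<noteq> 0" and n: "0 < n" "- v z < int n" and neg: "v z < 0 \<or> v y < 0"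
  shows "z + y ^ n \<noteq> 0 \<and> v (z + y ^ n) < 0"
proof -
  have y_n: "y ^ n \<noteq> 0" "v (y ^ n) = int n * v y" using y point_power by auto
  show ?thesis
  proof (cases "v y < 0")
    case True
    then have "int n * v y \<le> int n * (-1)" by (intro mult_left_mono) auto
    then have "v (y ^ n) < v z" "v (y ^ n) < 0" using y_n n by linarith+
    then show ?thesis using point_add_dominant[of "y ^ n" z] y_n
      by (simp add: ord_ge_def add.commute)
  next
    case False
    then have "v z < v (y ^ n)" "v z < 0" using neg y_n by (auto intro: less_le_trans)
    then show ?thesis using point_add_dominant[of z "y ^ n"] z by (simp add: ord_ge_def)
  qed
qed

end

lemma points_incomparable:
  assumes v: "v \<in> points K" and w: "w \<in> points K" and ne: "v \<noteq> w"
  shows "\<exists>f. f \<noteq> 0 \<and> 0 \<le> v f \<and> w f < 0"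
proof (rule ccontr)
  assume "\<not> ?thesis"
  then have nonneg: "\<And>f. f \<noteq> 0 \<Longrightarrow> 0 \<le> v f \<Longrightarrow> 0 \<le> w f" by force
  have unit: "w f = 0" if "f \<noteq> 0" "v f = 0" for f
    using nonneg[of f] nonneg[of "inverse f"] that
    by (simp add: point_inverse[OF v] point_inverse[OF w])
  obtain t where t: "t \<noteq> 0" "v t = 1" by (rule point_uniformizer[OF v])
  have multiple: "w f = v f * w t" if f: "f \<noteq> 0" for f
  proof -
    have "v (f / t powi v f) = 0" using f t by (simp add: point_divide[OF v] point_powi[OF v])
    then have "w (f / t powi v f) = 0" using f t by (intro unit) auto
    then show ?thesis using f t by (simp add: point_divide[OF w] point_powi[OF w])
  qed
  obtain s where s: "s \<noteq> 0" "w s = 1" by (rule point_uniformizer[OF w])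
  have "v s * w t = 1" using multiple[OF s(1)] s(2) by simp
  moreover have "0 \<le> w t" using nonneg t by simp
  ultimately have "w t = 1" by (auto simp: zmult_eq_1_iff)
  then have "w f = v f" for f
    using multiple[of f] point_zero[OF v] point_zero[OF w] by (cases "f = 0") auto
  then show False using ne by auto
qed

lemma points_separate:
  assumes v: "v \<in> points K" and w: "w \<in> points K" and ne: "v \<noteq> w"
  shows "\<exists>f. f \<noteq> 0 \<and> 0 < v f \<and> w f < 0"
proof -
  obtain a b where "a \<noteq> 0" "0 \<le> v a" "w a < 0" "b \<noteq> 0" "0 \<le> w b" "v b < 0"
    using points_incomparable[OF v w] points_incomparable[OF w v] ne by metis
  then show ?thesis
    by (intro exI[of _ "a / b"]) (auto simp: point_divide[OF v] point_divide[OF w])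
qed

lemma point_separate_finite:
  assumes v: "v \<in> points K" and "finite Z" "Z \<subseteq> points K" "v \<notin> Z"
  shows "\<exists>f. f \<noteq> 0 \<and> 0 < v f \<and> (\<forall>w\<in>Z. w f < 0)"
  using assms(2-)
proof (induction Z)
  case empty
  obtain t where "t \<noteq> 0" "v t = 1" by (rule point_uniformizer[OF v])
  then show ?case by (intro exI[of _ t]) auto
next
  case (insert u Z)
  then obtain z where z: "z \<noteq> 0" "0 < v z" "\<And>w. w \<in> Z \<Longrightarrow> w z < 0" by auto
  obtain y where y: "y \<noteq> 0" "0 < v y" "u y < 0"
    using points_separate[OF v, of u] insert.prems by auto
  define n where "n = Suc (\<Sum>w\<in>insert u Z. nat \<bar>w z\<bar>)"
  have "0 < n" by (simp add: n_def)
  have neg: "z + y ^ n \<noteq> 0 \<and> w (z + y ^ n) < 0" if w: "w \<in> insert u Z" for w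
  proof (rule point_add_dominant_neg[OF _ z(1) y(1)])
    show "w \<in> points K" using w insert.prems by blast
    have "nat \<bar>w z\<bar> \<le> (\<Sum>w\<in>insert u Z. nat \<bar>w z\<bar>)"
      by (rule member_le_sum) (use w insert.hyps in auto)
    then show "- w z < int n" unfolding n_def by linarith
    show "w z < 0 \<or> w y < 0" using w z(3) y(3) by auto
  qed (rule \<open>0 < n\<close>)
  have "0 < v (y ^ n)" using y \<open>0 < n\<close> by (simp add: point_power[OF v])
  then have "ord_ge v 1 (z + y ^ n)" using z(2) by (intro ord_ge_add[OF v]) (auto simp: ord_ge_def)
  then show ?case using neg by (intro exI[of _ "z + y ^ n"]) (auto simp: ord_ge_def)
qed

lemma point_indicator:
  assumes v: "v \<in> points K" and Z: "finite Z" "Z \<subseteq> points K" "v \<notin> Z"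
  shows "\<exists>e. ord_ge v (int n) (e - 1) \<and> (\<forall>w\<in>Z. ord_ge w (int n) e)"
proof -
  obtain z where z: "z \<noteq> 0" "0 < v z" "\<And>w. w \<in> Z \<Longrightarrow> w z < 0"
    using point_separate_finite[OF assms] by auto
  define y where "y = z ^ Suc n"
  have y: "y \<noteq> 0" "\<And>w. w \<in> points K \<Longrightarrow> w y = int (Suc n) * w z"
    using z(1) unfolding y_def by (simp_all only: power_not_zero point_power not_False_eq_True)
  have large: "int n < int (Suc n) * k" if "0 < k" for k :: int
  proof -
    have "int n < int (Suc n) * 1" by simp
    also have "\<dots> \<le> int (Suc n) * k" by (rule mult_left_mono) (use that in auto)
    finally show ?thesis .
  qed
  have "int n < v y" using large[OF z(2)] y(2)[OF v] by simp
  then have one_y: "1 + y \<noteq> 0" "v (1 + y) = 0"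
    using point_add_dominant[OF v, of 1 y] y(1) by (auto simp: point_one[OF v] ord_ge_def)
  have "1 / (1 + y) - 1 = - (y / (1 + y))" using one_y(1) by (simp add: field_simps)
  then have "ord_ge v (int n) (1 / (1 + y) - 1)"
    using \<open>int n < v y\<close> one_y y(1) by (simp add: ord_ge_def point_divide[OF v] point_uminus[OF v])
  moreover have "ord_ge w (int n) (1 / (1 + y))" if "w \<in> Z" for w
  proof -
    have w: "w \<in> points K" using that Z by auto
    have "int n < - w y" using large[of "- w z"] z(3)[OF that] y(2)[OF w] by simp
    then have "w (1 + y) = w y"
      using point_add_dominant(2)[OF w y(1), of 1] by (simp add: ord_ge_one[OF w] add.commute)
    then show ?thesis
      using \<open>int n < - w y\<close> one_y(1) by (simp add: ord_ge_def point_divide[OF w] point_one[OF w])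
  qed
  ultimately show ?thesis by blast
qed

lemma weak_approximation:
  fixes b :: "'f::field point \<Rightarrow> 'f" and n :: "'f point \<Rightarrow> int"
  assumes Z: "finite Z" "Z \<subseteq> points K"
  shows "\<exists>a. \<forall>v\<in>Z. ord_ge v (n v) (a - b v)"
proof -
  define N where "N = (\<Sum>v\<in>Z. nat \<bar>n v\<bar>)"
  define M where "M = (\<Sum>(v, w)\<in>Z \<times> Z. nat \<bar>w (b v)\<bar>)"
  have N: "n v \<le> int N" if "v \<in> Z" for v
  proof -
    have "nat \<bar>n v\<bar> \<le> N" unfolding N_def by (rule member_le_sum) (use that Z in auto)
    then show ?thesis by linarith
  qed
  have M: "ord_ge w (- int M) (b v)" if "v \<in> Z" "w \<in> Z" for v w
  proof -
    have "(case (v, w) of (v, w) \<Rightarrow> nat \<bar>w (b v)\<bar>) \<le> M"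
      unfolding M_def by (rule member_le_sum) (use that Z in auto)
    then show ?thesis unfolding ord_ge_def by simp linarith
  qed
  have "\<exists>e. ord_ge v (int (N + M)) (e - 1) \<and> (\<forall>w\<in>Z - {v}. ord_ge w (int (N + M)) e)"
    if "v \<in> Z" for v
    using point_indicator[of v K "Z - {v}" "N + M"] that Z by auto
  then obtain e where e: "\<And>v. v \<in> Z \<Longrightarrow> ord_ge v (int (N + M)) (e v - 1)"
    "\<And>v w. v \<in> Z \<Longrightarrow> w \<in> Z - {v} \<Longrightarrow> ord_ge w (int (N + M)) (e v)" by metis
  show ?thesis
  proof (intro exI[of _ "\<Sum>v\<in>Z. b v * e v"] ballI)
    fix w assume w: "w \<in> Z"
    then have wK: "w \<in> points K" using Z by auto
    have "ord_ge w (- int M + int (N + M)) (b w * (e w - 1))"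
      by (rule ord_ge_mult[OF wK M e(1)]) (use w in auto)
    moreover have "ord_ge w (- int M + int (N + M)) (\<Sum>v\<in>Z-{w}. b v * e v)"
      by (intro ord_ge_sum[OF wK] ord_ge_mult[OF wK M e(2)]) (use w in auto)
    ultimately have "ord_ge w (int N) (b w * (e w - 1) + (\<Sum>v\<in>Z-{w}. b v * e v))"
      using ord_ge_add[OF wK] by simp
    moreover have "(\<Sum>v\<in>Z. b v * e v) - b w = b w * (e w - 1) + (\<Sum>v\<in>Z-{w}. b v * e v)"
      using w Z by (simp add: sum.remove algebra_simps)
    ultimately show "ord_ge w (n w) ((\<Sum>v\<in>Z. b v * e v) - b w)" using N[OF w] ord_ge_mono by metis
  qed
qed

lemma prescribed_orders:
  fixes n :: "'f::field point \<Rightarrow> int"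
  assumes Z: "finite Z" "Z \<subseteq> points K"
  shows "\<exists>f. \<forall>v\<in>Z. f \<noteq> 0 \<and> v f = n v"
proof -
  have "\<exists>t. t \<noteq> 0 \<and> v t = n v" if "v \<in> Z" for v
  proof -
    have v: "v \<in> points K" using that Z by auto
    obtain t where "t \<noteq> 0" "v t = 1" by (rule point_uniformizer[OF v])
    then show ?thesis by (intro exI[of _ "t powi n v"]) (simp add: point_powi[OF v])
  qed
  then obtain b where b: "\<And>v. v \<in> Z \<Longrightarrow> b v \<noteq> 0 \<and> v (b v) = n v" by metis
  obtain f where f: "\<And>v. v \<in> Z \<Longrightarrow> ord_ge v (n v + 1) (f - b v)"
    using weak_approximation[OF Z, of "\<lambda>v. n v + 1" b] by blast
  have "f \<noteq> 0 \<and> v f = n v" if "v \<in> Z" for v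
    using point_add_dominant[of v K "b v" "f - b v"] b[OF that] f[OF that] Z(2) that by auto
  then show ?thesis by blast
qed

section \<open>Sections of divisors\<close>

lemma divisors_zero: "0 \<in> divisors K"
  by (simp add: divisors_def)

lemma divisors_add: "A \<in> divisors K \<Longrightarrow> B \<in> divisors K \<Longrightarrow> A + B \<in> divisors K"
  unfolding divisors_def using keys_add[of A B] by blast

lemma divisors_diff: "A \<in> divisors K \<Longrightarrow> B \<in> divisors K \<Longrightarrow> A - B \<in> divisors K"
  unfolding divisors_def using keys_diff[of A B] by blast

lemma divisors_point: "v \<in> points K \<Longrightarrow> frag_of v \<in> divisors K"
  by (simp add: divisors_def)

lemma divisors_frag_cmul: "D \<in> divisors K \<Longrightarrow> frag_cmul k D \<in> divisors K"
  unfolding divisors_def using keys_cmul[of k D] by blast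

lemma divisor_degree_superset:
  assumes "finite Z" "Poly_Mapping.keys D \<subseteq> Z"
  shows "divisor_degree K D = (\<Sum>P\<in>Z. Poly_Mapping.lookup D P * int (point_degree K P))"
  unfolding divisor_degree_def
  using assms by (intro sum.mono_neutral_left) (auto simp: in_keys_iff)

lemma divisor_degree_diff: "divisor_degree K (A - B) = divisor_degree K A - divisor_degree K B"
proof -
  let ?Z = "Poly_Mapping.keys A \<union> Poly_Mapping.keys B"
  show ?thesis
    using divisor_degree_superset[of ?Z] keys_diff[of A B]
    by (simp add: lookup_minus left_diff_distrib sum_subtractf)
qed

lemma divisor_degree_add: "divisor_degree K (A + B) = divisor_degree K A + divisor_degree K B"
  using divisor_degree_diff[of K "A + B" B] by simp

lemma divisor_degree_zero: "divisor_degree K 0 = 0"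
  by (simp add: divisor_degree_def)

lemma divisor_degree_point: "divisor_degree K (frag_of v) = int (point_degree K v)"
  by (simp add: divisor_degree_def)

lemma divisor_degree_frag_cmul: "divisor_degree K (frag_cmul k D) = k * divisor_degree K D"
  using divisor_degree_superset[of "Poly_Mapping.keys D" "frag_cmul k D"] keys_cmul[of k D]
  by (simp add: divisor_degree_def sum_distrib_left mult.assoc)

lemma effective_add: "effective A \<Longrightarrow> effective B \<Longrightarrow> effective (A + B)"
  by (simp add: effective_def lookup_add)

lemma effective_point: "effective (frag_of v)"
  by (simp add: effective_def lookup_single when_def)

lemma effective_frag_cmul: "effective D \<Longrightarrow> effective (frag_cmul (int k) D)"
  by (simp add: effective_def)

lemma divisor_degree_nonneg: "effective D \<Longrightarrow> 0 \<le> divisor_degree K D"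
  unfolding divisor_degree_def by (intro sum_nonneg) (simp add: effective_def)

lemma keys_add_effective:
  assumes "effective A" "effective B"
  shows "Poly_Mapping.keys (A + B) = Poly_Mapping.keys A \<union> Poly_Mapping.keys B"
  using assms by (auto simp: effective_def in_keys_iff lookup_add) (metis add_nonneg_eq_0_iff)+

lemma effective_induct [consumes 1, case_names zero add_point]:
  assumes "effective D" "P 0" "\<And>D v. effective D \<Longrightarrow> P D \<Longrightarrow> P (D + frag_of v)"
  shows "P D"
  using assms(1)
proof (induction "nat (\<Sum>v\<in>Poly_Mapping.keys D. Poly_Mapping.lookup D v)" arbitrary: D
    rule: less_induct)
  case less
  let ?size = "\<lambda>D. \<Sum>v\<in>Poly_Mapping.keys D. Poly_Mapping.lookup D v"
  show ?case
  proof (cases "D = 0")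
    case False
    then obtain v where v: "v \<in> Poly_Mapping.keys D" by (metis all_not_in_conv keys_eq_empty)
    define E where "E = D - frag_of v"
    have "0 < Poly_Mapping.lookup D v"
      using less.prems v by (simp add: effective_def in_keys_iff order_less_le)
    then have E: "effective E"
      using less.prems by (simp add: E_def effective_def lookup_minus lookup_single when_def)
    have "?size E = (\<Sum>w\<in>Poly_Mapping.keys D. Poly_Mapping.lookup E w)"
      using v keys_diff[of D "frag_of v"]
      by (intro sum.mono_neutral_left) (auto simp: E_def in_keys_iff)
    also have "\<dots> < ?size D"
      using v by (intro sum_strict_mono_ex1) (auto simp: E_def lookup_minus lookup_single when_def)
    finally have "?size E < ?size D" .
    moreover have "0 \<le> ?size E" using E by (intro sum_nonneg) (simp add: effective_def)
    ultimately have "P E" using less.hyps[of E] E by simp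
    from assms(3)[OF E this, of v] show ?thesis by (simp add: E_def)
  qed (use assms(2) in simp)
qed

definition sections :: "'f::field point set \<Rightarrow> 'f divisor \<Rightarrow> 'f set" where
  "sections Z D = {f. \<forall>P\<in>Z. ord_ge P (- Poly_Mapping.lookup D P) f}"

lemma RR_space_eq_sections: "RR_space K D = sections (points K) D"
  by (auto simp: RR_space_def sections_def ord_ge_def)

lemma sections_0 [simp]: "0 \<in> sections Z D"
  by (simp add: sections_def)

lemma sections_mono:
  assumes "\<And>P. P \<in> Z \<Longrightarrow> Poly_Mapping.lookup D P \<le> Poly_Mapping.lookup E P"
  shows "sections Z D \<subseteq> sections Z E"
  unfolding sections_def using assms by (auto elim!: ord_ge_mono)

lemma sections_subset_add_effective:
  assumes "effective E" shows "sections Z D \<subseteq> sections Z (D + E)"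
  by (rule sections_mono) (use assms in \<open>simp add: effective_def lookup_add\<close>)

lemma sections_minus_point:
  assumes "v \<in> Z"
  shows "f \<in> sections Z (D - frag_of v) \<longleftrightarrow>
    f \<in> sections Z D \<and> ord_ge v (1 - Poly_Mapping.lookup D v) f"
proof -
  have "- Poly_Mapping.lookup (D - frag_of v) P
      = (if P = v then 1 - Poly_Mapping.lookup D v else - Poly_Mapping.lookup D P)" for P
    by (simp add: lookup_minus lookup_single)
  moreover have "ord_ge v (- Poly_Mapping.lookup D v) f"
    if "ord_ge v (1 - Poly_Mapping.lookup D v) f"
    by (rule ord_ge_mono[OF that]) simp
  ultimately show ?thesis using assms by (auto simp: sections_def)
qed

context
  fixes Z :: "'f::field point set" and K :: "'f set"
  assumes Z: "Z \<subseteq> points K"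
begin

lemma sections_add: "f \<in> sections Z D \<Longrightarrow> g \<in> sections Z D \<Longrightarrow> f + g \<in> sections Z D"
  unfolding sections_def using Z ord_ge_add by blast

lemma sections_diff: "f \<in> sections Z D \<Longrightarrow> g \<in> sections Z D \<Longrightarrow> f - g \<in> sections Z D"
  unfolding sections_def using Z ord_ge_diff by blast

lemma sections_mult:
  assumes "f \<in> sections Z D" "g \<in> sections Z E" shows "f * g \<in> sections Z (D + E)"
  unfolding sections_def
proof (intro CollectI ballI)
  fix P assume P: "P \<in> Z"
  have "ord_ge P (- Poly_Mapping.lookup D P + - Poly_Mapping.lookup E P) (f * g)"
    using assms P Z by (intro ord_ge_mult[of P K]) (auto simp: sections_def)
  then show "ord_ge P (- Poly_Mapping.lookup (D + E) P) (f * g)" by (simp add: lookup_add)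
qed

lemma subring_sections_zero: "subring (sections Z 0) fring"
proof (rule subring_fringI)
  show "1 \<in> sections Z 0" using Z ord_ge_one by (force simp: sections_def)
  show "f - g \<in> sections Z 0" "f * g \<in> sections Z 0"
    if "f \<in> sections Z 0" "g \<in> sections Z 0" for f g
    using sections_diff[OF that] sections_mult[OF that] by simp_all
qed

lemma mult_sections_zero_subset: "g \<in> sections Z D \<Longrightarrow> (*) g ` sections Z 0 \<subseteq> sections Z D"
  using sections_mult[of g D _ 0] by auto

end

section \<open>Residue fields\<close>

lemma (in ring) card_dimension:
  assumes K: "subfield K R" "finite K" and E: "dimension n K E"
  shows "card E = card K ^ n"
proof -
  obtain Vs where Vs: "set Vs \<subseteq> carrier R" "independent K Vs" "length Vs = n" "Span K Vs = E"
    using exists_base[OF K(1) E] by blast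
  let ?L = "{Ks. set Ks \<subseteq> K \<and> length Ks = n}"
  have img: "(\<lambda>Ks. combine Ks Vs) ` ?L = E"
    using Span_eq_combine_set_length_version[OF K(1) Vs(1)] Vs(3,4) by auto
  have "inj_on (\<lambda>Ks. combine Ks Vs) ?L"
  proof (rule inj_onI)
    fix Ks Ks' assume Ks: "Ks \<in> ?L" "Ks' \<in> ?L" "combine Ks Vs = combine Ks' Vs"
    then have "combine Ks Vs \<in> Span K Vs" using img Vs(4) by blast
    from unique_decomposition[OF K(1) Vs(2) this] show "Ks = Ks'" using Ks Vs(3) by auto
  qed
  then have "card E = card ?L" unfolding img[symmetric] by (rule card_image)
  then show ?thesis by (simp add: card_lists_length_eq[OF K(2)])
qed

lemma (in ring) dimension_finite_ring:
  assumes K: "subfield K R" and "finite (carrier R)"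
  shows "dimension (dim K (carrier R)) K (carrier R)"
proof -
  obtain Us where Us: "set Us = carrier R" using finite_list[OF assms(2)] by blast
  then have "Span K Us = carrier R"
    using Span_base_incl[OF K, of Us] Span_subgroup_props(1)[OF K, of Us] by auto
  then have "finite_dimension K (carrier R)" using Span_finite_dimension[OF K, of Us] Us by auto
  from finite_dimensionE[OF K this] show ?thesis unfolding over_def .
qed

lemma mem_max_ideal: "f \<in> max_ideal v \<longleftrightarrow> ord_ge v 1 f"
  by (auto simp: max_ideal_def ord_ge_def)

lemma mem_carrier_local_ring: "f \<in> carrier (local_ring v) \<longleftrightarrow> ord_ge v 0 f"
  by (auto simp: local_ring_def ord_ge_def)

lemma max_ideal_zero_closed: "0 \<in> max_ideal v"
  by (simp add: mem_max_ideal)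

lemma max_ideal_subset_local_ring: "max_ideal v \<subseteq> carrier (local_ring v)"
  using ord_ge_mono by (force simp: mem_max_ideal mem_carrier_local_ring)

lemma carrier_local_ring_eq_sections: "carrier (local_ring v) = sections {v} 0"
  by (auto simp: mem_carrier_local_ring sections_def)

lemma max_ideal_eq_sections: "max_ideal v = sections {v} (- frag_of v)"
  by (auto simp: mem_max_ideal sections_def)

lemma local_ring_ops [simp]:
  "x \<oplus>\<^bsub>local_ring v\<^esub> y = x + y" "x \<otimes>\<^bsub>local_ring v\<^esub> y = x * y"
  "\<zero>\<^bsub>local_ring v\<^esub> = 0" "\<one>\<^bsub>local_ring v\<^esub> = 1"
  by (simp_all add: local_ring_def)

context
  fixes v :: "'f::field point" and K :: "'f set"
  assumes v: "v \<in> points K"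
begin

lemma subring_carrier_local_ring: "subring (carrier (local_ring v)) fring"
  unfolding carrier_local_ring_eq_sections by (rule subring_sections_zero[of _ K]) (use v in simp)

lemma ring_local_ring: "ring (local_ring v)"
proof -
  have "local_ring v = fring\<lparr>carrier := carrier (local_ring v)\<rparr>" by (simp add: local_ring_def)
  then show ?thesis using fring.subring_is_ring[OF subring_carrier_local_ring] by simp
qed

lemma minus_local_ring:
  assumes "a \<in> carrier (local_ring v)" "b \<in> carrier (local_ring v)"
  shows "a \<ominus>\<^bsub>local_ring v\<^esub> b = a - b"
proof -
  interpret R: ring "local_ring v" by (rule ring_local_ring)
  have "- b \<in> carrier (local_ring v)"
    by (rule subring_fringD(3)[OF subring_carrier_local_ring assms(2)])
  then have "\<ominus>\<^bsub>local_ring v\<^esub> b = - b" using R.minus_equality[of "- b" b] assms(2) by simp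
  then show ?thesis by (simp add: a_minus_def)
qed

lemma max_ideal_diff_closed: "a \<in> max_ideal v \<Longrightarrow> b \<in> max_ideal v \<Longrightarrow> a - b \<in> max_ideal v"
  using ord_ge_diff[OF v] by (simp add: mem_max_ideal)

lemma ideal_max_ideal: "ideal (max_ideal v) (local_ring v)"
proof (rule idealI[OF ring_local_ring])
  interpret R: ring "local_ring v" by (rule ring_local_ring)
  note sub = subsetD[OF max_ideal_subset_local_ring]
  show "subgroup (max_ideal v) (add_monoid (local_ring v))"
  proof (rule R.add.subgroupI)
    show "max_ideal v \<subseteq> carrier (local_ring v)" by (rule max_ideal_subset_local_ring)
    show "max_ideal v \<noteq> {}" using max_ideal_zero_closed by blast
    show "\<ominus>\<^bsub>local_ring v\<^esub> a \<in> max_ideal v" if "a \<in> max_ideal v" for a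
    proof -
      have "\<ominus>\<^bsub>local_ring v\<^esub> a = 0 - a"
        using minus_local_ring[of 0 a] sub[OF that] sub[OF max_ideal_zero_closed] R.minus_eq
        by (metis R.add.inv_closed R.l_zero local_ring_ops(3))
      then show ?thesis using max_ideal_diff_closed[OF max_ideal_zero_closed that] by simp
    qed
    show "a \<oplus>\<^bsub>local_ring v\<^esub> b \<in> max_ideal v" if "a \<in> max_ideal v" "b \<in> max_ideal v" for a b
      using that ord_ge_add[OF v] by (simp add: mem_max_ideal)
  qed
  show "x \<otimes>\<^bsub>local_ring v\<^esub> a \<in> max_ideal v" "a \<otimes>\<^bsub>local_ring v\<^esub> x \<in> max_ideal v"
    if "a \<in> max_ideal v" "x \<in> carrier (local_ring v)" for a x
    using that ord_ge_mult[OF v, of 1 a 0 x]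
    by (simp_all add: mem_max_ideal mem_carrier_local_ring mult.commute)
qed

abbreviation residue :: "'f \<Rightarrow> 'f set" where
  "residue \<equiv> (\<lambda>c. max_ideal v +>\<^bsub>local_ring v\<^esub> c)"

lemma residue_eq_iff:
  assumes "a \<in> carrier (local_ring v)" "b \<in> carrier (local_ring v)"
  shows "residue a = residue b \<longleftrightarrow> a - b \<in> max_ideal v"
proof -
  interpret R: ring "local_ring v" by (rule ring_local_ring)
  show ?thesis
    using R.quotient_eq_iff_same_a_r_cos[OF ideal_max_ideal assms] minus_local_ring[OF assms]
    by simp
qed

lemma inj_on_residue:
  assumes "T \<subseteq> carrier (local_ring v)" "incongruent (max_ideal v) T"
  shows "inj_on residue T"
proof (rule inj_onI)
  fix a b assume ab: "a \<in> T" "b \<in> T" "residue a = residue b"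
  then have "a - b \<in> max_ideal v" using residue_eq_iff[of a b] assms(1) by (simp add: subset_iff)
  then show "a = b" by (rule incongruentD[OF assms(2) ab(1,2)])
qed

lemma carrier_residue_field: "carrier (residue_field v) = residue ` carrier (local_ring v)"
  by (auto simp: residue_field_def FactRing_def A_RCOSETS_def')

lemma residue_ring_hom: "ring_hom_ring (local_ring v) (residue_field v) residue"
  unfolding residue_field_def by (rule ideal.rcos_ring_hom_ring[OF ideal_max_ideal])

lemma residue_field_one_not_zero: "\<one>\<^bsub>residue_field v\<^esub> \<noteq> \<zero>\<^bsub>residue_field v\<^esub>"
proof
  interpret ring_hom_ring "local_ring v" "residue_field v" residue by (rule residue_ring_hom)
  assume "\<one>\<^bsub>residue_field v\<^esub> = \<zero>\<^bsub>residue_field v\<^esub>"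
  then have "residue 1 = residue 0" using hom_one hom_zero by simp
  then have "1 - 0 \<in> max_ideal v"
    using residue_eq_iff[of 1 0] subring_fringD(1,2)[OF subring_carrier_local_ring] by blast
  then show False by (simp add: mem_max_ideal ord_ge_one[OF v])
qed

lemma card_residue_field:
  assumes T: "residue_system (max_ideal v) (carrier (local_ring v)) T"
  shows "finite (carrier (residue_field v))" "card (carrier (residue_field v)) = card T"
proof -
  have sub: "T \<subseteq> carrier (local_ring v)" and fin: "finite T"
    using T by (auto simp: residue_system_def)
  have "inj_on residue T" using T by (intro inj_on_residue sub) (simp add: residue_system_def)
  moreover have "residue ` T = carrier (residue_field v)"
  proof
    show "residue ` T \<subseteq> carrier (residue_field v)"
      unfolding carrier_residue_field by (rule image_mono[OF sub])
    show "carrier (residue_field v) \<subseteq> residue ` T"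
      unfolding carrier_residue_field
    proof (rule image_subsetI)
      fix r assume r: "r \<in> carrier (local_ring v)"
      obtain a where a: "a \<in> T" "r - a \<in> max_ideal v"
        using residue_system_covers[OF T r] by (rule bexE)
      have "residue r = residue a" using residue_eq_iff[OF r subsetD[OF sub a(1)]] a(2) by simp
      then show "residue r \<in> residue ` T" using a(1) by (rule image_eqI)
    qed
  qed
  ultimately show "finite (carrier (residue_field v))" "card (carrier (residue_field v)) = card T"
    using fin card_image[of residue T] by (metis finite_imageI)+
qed

end

lemma K_subset_local_ring: "v \<in> points K \<Longrightarrow> K \<subseteq> carrier (local_ring v)"
  using point_const by (force simp: mem_carrier_local_ring ord_ge_def)

lemma index_le_sections:
  assumes "Z \<subseteq> points K" "g \<noteq> 0" "digit_growth_le g C" "g \<in> sections Z 0" "g \<in> sections Z D"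
  shows "index_le (sections Z D) (sections Z 0) C"
proof -
  have "index_le ((*) g ` sections Z 0) (sections Z 0) C"
    using index_le_digit_growth[OF assms(3) subring_sections_zero[OF assms(1)]] assms by blast
  then show ?thesis
    using incongruent_antimono mult_sections_zero_subset[OF assms(1,5)] unfolding index_le_def
    by blast
qed

context finite_field_curve
begin

lemma two_le_card_K: "2 \<le> card K"
proof -
  have "card {0, 1 :: 'f} \<le> card K"
    using subring_fringD(1,2)[OF subring_K] finite_K by (intro card_mono) auto
  then show ?thesis by simp
qed

lemma K_incongruent: "v \<in> points K \<Longrightarrow> incongruent (max_ideal v) K"
  using subring_fringD(5)[OF subring_K] point_const
  by (force simp: incongruent_def mem_max_ideal ord_ge_def)

lemma local_residue_system_exists:
  assumes v: "v \<in> points K"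
  shows "\<exists>T. residue_system (max_ideal v) (carrier (local_ring v)) T"
proof -
  obtain t where t: "t \<noteq> 0" "v t = 1" by (rule point_uniformizer[OF v])
  obtain C where "digit_growth_le t C" using ex_digit_growth ..
  then have "index_le (sections {v} (- frag_of v)) (sections {v} 0) C"
    using t v by (intro index_le_sections) (auto simp: sections_def ord_ge_def)
  then show ?thesis
    unfolding carrier_local_ring_eq_sections max_ideal_eq_sections
    using v by (intro residue_system_exists) (auto intro: sections_diff[of _ K])
qed

lemma card_local_residue_system:
  assumes v: "v \<in> points K" and T: "residue_system (max_ideal v) (carrier (local_ring v)) T"
  shows "card T = card K ^ point_degree K v"
proof -
  interpret ring_hom_ring "local_ring v" "residue_field v" "residue v"
    by (rule residue_ring_hom[OF v])
  have "subfield K (local_ring v)"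
    using R.subfield_iff(1)[of K] fring.subfield_iff(2)[OF subfield_K] K_subset_local_ring[OF v]
    by (simp add: local_ring_def)
  then have K: "subfield (residue v ` K) (residue_field v)"
    by (rule img_is_subfield[OF _ residue_field_one_not_zero[OF v]])
  have "inj_on (residue v) K"
    by (rule inj_on_residue[OF v K_subset_local_ring[OF v] K_incongruent[OF v]])
  then have "card (residue v ` K) = card K" by (rule card_image)
  moreover have "S.dimension (point_degree K v) (residue v ` K) (carrier (residue_field v))"
    unfolding point_degree_def by (rule S.dimension_finite_ring[OF K card_residue_field(1)[OF v T]])
  ultimately show ?thesis
    using S.card_dimension[OF K] finite_K card_residue_field(2)[OF v T] by simp
qed

lemma point_degree_pos:
  assumes v: "v \<in> points K" shows "0 < point_degree K v"
proof -
  obtain T where T: "residue_system (max_ideal v) (carrier (local_ring v)) T"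
    using local_residue_system_exists[OF v] ..
  have "card K \<le> card T"
    using card_incongruent_le[OF max_ideal_zero_closed max_ideal_diff_closed[OF v] T]
      K_subset_local_ring[OF v] K_incongruent[OF v] by blast
  then have "card K ^ 1 \<le> card K ^ point_degree K v" using card_local_residue_system[OF v T] by simp
  then show ?thesis using two_le_card_K by (cases "point_degree K v") auto
qed

lemma rational_point_residue_system:
  assumes v: "v \<in> rational_points K"
  shows "residue_system (max_ideal v) (carrier (local_ring v)) K"
proof -
  have vK: "v \<in> points K" and deg: "point_degree K v = 1"
    using v by (auto simp: rational_points_def)
  obtain T where T: "residue_system (max_ideal v) (carrier (local_ring v)) T"
    using local_residue_system_exists[OF vK] ..
  have "card K = card T" using card_local_residue_system[OF vK T] deg by simp
  then show ?thesis
    using residue_system_if_card_eq[OF max_ideal_zero_closed max_ideal_diff_closed[OF vK] T]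
      K_subset_local_ring[OF vK] K_incongruent[OF vK] by blast
qed

lemma lifted_incongruent:
  assumes Z: "finite Z" "Z \<subseteq> points K" and v: "v \<in> Z"
  shows "\<exists>T\<subseteq>sections Z 0. finite T \<and> card T = card K ^ point_degree K v \<and> incongruent (max_ideal v) T"
proof -
  have vK: "v \<in> points K" using Z v by blast
  obtain T where T: "residue_system (max_ideal v) (carrier (local_ring v)) T"
    using local_residue_system_exists[OF vK] ..
  have "\<exists>b\<in>sections Z 0. b - a \<in> max_ideal v" if a: "a \<in> T" for a
  proof -
    obtain b where b: "\<And>w. w \<in> Z \<Longrightarrow> ord_ge w (if w = v then 1 else 0) (b - (if w = v then a else 0))"
      using weak_approximation[OF Z, of "\<lambda>w. if w = v then 1 else 0" "\<lambda>w. if w = v then a else 0"]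
      by blast
    have "ord_ge v 0 ((b - a) + a)"
      using b[OF v] T a ord_ge_mono[of v 1 "b - a" 0]
      by (intro ord_ge_add[OF vK]) (auto simp: residue_system_def mem_carrier_local_ring)
    then have "ord_ge w 0 b" if "w \<in> Z" for w using b[OF that] by (cases "w = v") auto
    then show ?thesis using b[OF v] by (auto simp: sections_def mem_max_ideal)
  qed
  then obtain \<beta> where \<beta>: "\<And>a. a \<in> T \<Longrightarrow> \<beta> a \<in> sections Z 0 \<and> \<beta> a - a \<in> max_ideal v" by metis
  have eq: "a = b" if "a \<in> T" "b \<in> T" "\<beta> a - \<beta> b \<in> max_ideal v" for a b
  proof -
    have "(\<beta> a - \<beta> b) - (\<beta> a - a) \<in> max_ideal v"
      using max_ideal_diff_closed[OF vK that(3)] \<beta>[OF that(1)] by blast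
    then have "a - \<beta> b \<in> max_ideal v" by simp
    then have "(a - \<beta> b) - (0 - (\<beta> b - b)) \<in> max_ideal v"
      using max_ideal_diff_closed[OF vK] max_ideal_zero_closed \<beta>[OF that(2)] by blast
    then show ?thesis using T that by (auto simp: residue_system_def dest: incongruentD)
  qed
  have "inj_on \<beta> T" using eq by (intro inj_onI) (simp add: max_ideal_zero_closed)
  then have "card (\<beta> ` T) = card K ^ point_degree K v"
    using card_local_residue_system[OF vK T] by (simp add: card_image)
  moreover have "incongruent (max_ideal v) (\<beta> ` T)" using eq by (auto simp: incongruent_def)
  moreover have "\<beta> ` T \<subseteq> sections Z 0" using \<beta> by blast
  moreover have "finite (\<beta> ` T)" using T by (simp add: residue_system_def)
  ultimately show ?thesis by blast
qed

end

text \<open>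
  A function \<open>\<pi>\<close> whose divisor is \<open>N\<close> on \<open>Z\<close> turns digits modulo \<open>v\<close> into the next digits
  after a residue modulo \<open>N\<close>.
\<close>

lemma incongruent_next_digit:
  assumes Z: "Z \<subseteq> points K" "v \<in> Z" and \<pi>: "\<And>w. w \<in> Z \<Longrightarrow> \<pi> \<noteq> 0 \<and> w \<pi> = Poly_Mapping.lookup N w"
    and T: "incongruent (sections Z (- N)) T"
    and S: "S \<subseteq> sections Z 0" "incongruent (max_ideal v) S"
    and a: "a \<in> T" "b \<in> T" "s \<in> S" "t \<in> S"
    and cong: "(a + \<pi> * s) - (b + \<pi> * t) \<in> sections Z (- (N + frag_of v))"
  shows "a = b \<and> s = t"
proof -
  have vK: "v \<in> points K" using Z by blast
  have "- (N + frag_of v) = - N - frag_of v" by simp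
  then have cong_v: "(a + \<pi> * s) - (b + \<pi> * t) \<in> sections Z (- N)"
    "ord_ge v (1 + Poly_Mapping.lookup N v) ((a + \<pi> * s) - (b + \<pi> * t))"
    using cong sections_minus_point[OF Z(2)] by (metis, metis diff_minus_eq_add lookup_uminus)
  have "\<pi> \<in> sections Z (- N)" using \<pi> by (simp add: sections_def ord_ge_def)
  moreover have "t - s \<in> sections Z 0" using S(1) a(3,4) by (intro sections_diff[OF Z(1)]) blast+
  ultimately have "\<pi> * (t - s) \<in> sections Z (- N)"
    using sections_mult[OF Z(1), of \<pi> "- N" "t - s" 0] by simp
  from sections_add[OF Z(1) cong_v(1) this] have "a - b \<in> sections Z (- N)"
    by (simp add: algebra_simps)
  then have "a = b" using incongruentD[OF T a(1,2)] by blast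
  then have "ord_ge v (1 + Poly_Mapping.lookup N v) ((s - t) * \<pi>)"
    using cong_v(2) by (simp add: algebra_simps)
  then have "s - t \<in> max_ideal v"
    using ord_ge_mult_iff[OF vK, of \<pi>] \<pi>[OF Z(2)] by (simp add: mem_max_ideal)
  then show ?thesis using \<open>a = b\<close> incongruentD[OF S(2) a(3,4)] by blast
qed

lemma incongruent_next_digits:
  assumes Z: "Z \<subseteq> points K" "v \<in> Z" and \<pi>: "\<And>w. w \<in> Z \<Longrightarrow> \<pi> \<noteq> 0 \<and> w \<pi> = Poly_Mapping.lookup N w"
    and T: "incongruent (sections Z (- N)) T"
    and S: "S \<subseteq> sections Z 0" "incongruent (max_ideal v) S"
  shows "inj_on (\<lambda>(a, s). a + \<pi> * s) (T \<times> S)"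
    and "incongruent (sections Z (- (N + frag_of v))) ((\<lambda>(a, s). a + \<pi> * s) ` (T \<times> S))"
proof -
  note eq = incongruent_next_digit[OF Z \<pi> T S]
  show "inj_on (\<lambda>(a, s). a + \<pi> * s) (T \<times> S)"
  proof (rule inj_onI, clarify)
    fix a b s t assume mem: "a \<in> T" "s \<in> S" "b \<in> T" "t \<in> S" and "a + \<pi> * s = b + \<pi> * t"
    then show "a = b \<and> s = t" using eq[OF _ mem(1,3,2,4)] by simp
  qed
  show "incongruent (sections Z (- (N + frag_of v))) ((\<lambda>(a, s). a + \<pi> * s) ` (T \<times> S))"
    unfolding incongruent_def using eq by auto
qed

lemma (in finite_field_curve) semilocal_incongruent:
  assumes Z: "finite Z" "Z \<subseteq> points K" and N: "effective N" "Poly_Mapping.keys N \<subseteq> Z"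
  shows "\<exists>T\<subseteq>sections Z 0. finite T \<and> card T = card K ^ nat (divisor_degree K N)
    \<and> incongruent (sections Z (- N)) T"
  using N
proof (induction N rule: effective_induct)
  case zero
  show ?case by (intro exI[of _ "{0}"]) (simp add: incongruent_def divisor_degree_zero)
next
  case (add_point N v)
  then have keys: "Poly_Mapping.keys N \<subseteq> Z" "v \<in> Z"
    using keys_add_effective[OF add_point.hyps effective_point[of v]] by auto
  obtain T where T: "T \<subseteq> sections Z 0" "finite T" "card T = card K ^ nat (divisor_degree K N)"
    "incongruent (sections Z (- N)) T" using add_point.IH[OF keys(1)] by blast
  obtain S where S: "S \<subseteq> sections Z 0" "finite S" "card S = card K ^ point_degree K v"
    "incongruent (max_ideal v) S" using lifted_incongruent[OF Z keys(2)] by blast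
  obtain \<pi> where \<pi>: "\<And>w. w \<in> Z \<Longrightarrow> \<pi> \<noteq> 0 \<and> w \<pi> = Poly_Mapping.lookup N w"
    using prescribed_orders[OF Z] by metis
  let ?h = "\<lambda>(a, s). a + \<pi> * s"
  note next_digits = incongruent_next_digits[OF Z(2) keys(2) \<pi> T(4) S(1,4)]
  from next_digits(1) have "card (?h ` (T \<times> S)) = card K ^ (nat (divisor_degree K N) + point_degree K v)"
    by (simp add: card_image card_cartesian_product T(3) S(3) power_add)
  also have "nat (divisor_degree K N) + point_degree K v = nat (divisor_degree K (N + frag_of v))"
    using divisor_degree_nonneg[OF add_point.hyps, of K]
    by (simp add: divisor_degree_add divisor_degree_point nat_add_distrib)
  finally have "card (?h ` (T \<times> S)) = card K ^ nat (divisor_degree K (N + frag_of v))" .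
  moreover note next_digits(2)
  moreover have "ord_ge w 0 \<pi>" if "w \<in> Z" for w
    using \<pi>[OF that] add_point.hyps by (simp add: ord_ge_def effective_def)
  then have "\<pi> \<in> sections Z 0" by (simp add: sections_def)
  then have "?h ` (T \<times> S) \<subseteq> sections Z 0"
    using T(1) S(1) subring_fringD(4,6)[OF subring_sections_zero[OF Z(2)]]
    by (auto simp: subset_iff)
  moreover have "finite (?h ` (T \<times> S))" using T(2) S(2) by simp
  ultimately show ?case by blast
qed

section \<open>Riemann-Roch spaces and degrees\<close>

lemma digit_sums_subset_RR_space:
  assumes "effective A" "f \<in> RR_space K A" "T \<subseteq> RR_space K E"
  shows "digit_sums T f m \<subseteq> RR_space K (E + frag_cmul (int m) A)"
proof (induction m)
  case 0
  then show ?case by (simp add: RR_space_eq_sections)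
next
  case (Suc m)
  note A = effective_frag_cmul[OF assms(1)]
  have shift: "A + (E + frag_cmul (int m) A) = E + frag_cmul (int (Suc m)) A"
    by (simp add: frag_cmul_distrib add.left_commute)
  show ?case
  proof
    fix x assume "x \<in> digit_sums T f (Suc m)"
    then obtain a s where x: "x = a + f * s" "a \<in> T" "s \<in> digit_sums T f m" by auto
    have "f * s \<in> RR_space K (A + (E + frag_cmul (int m) A))"
      unfolding RR_space_eq_sections
      by (rule sections_mult[OF order_refl]) (use assms(2) x(3) Suc in \<open>auto simp: RR_space_eq_sections\<close>)
    moreover have "a \<in> RR_space K (E + frag_cmul (int (Suc m)) A)"
      using sections_subset_add_effective[OF A[of "Suc m"], of _ E] assms(3) x(2)
      unfolding RR_space_eq_sections by blast
    ultimately show "x \<in> RR_space K (E + frag_cmul (int (Suc m)) A)"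
      unfolding x(1) shift RR_space_eq_sections by (intro sections_add[OF order_refl])
  qed
qed

context finite_field_curve
begin

lemma finite_zeros:
  assumes g: "g \<noteq> 0" shows "finite {v \<in> points K. 0 < v g}"
proof (rule ccontr)
  assume inf: "infinite {v \<in> points K. 0 < v g}"
  obtain C where C: "digit_growth_le g C" using ex_digit_growth ..
  obtain Z where Z: "finite Z" "card Z = C" "Z \<subseteq> {v \<in> points K. 0 < v g}"
    using infinite_arbitrarily_large[OF inf] by blast
  define N where "N = (\<Sum>v\<in>Z. frag_of v)"
  have lookup: "Poly_Mapping.lookup N v = (if v \<in> Z then 1 else 0)" for v
    using Z(1) by (simp add: N_def lookup_sum lookup_single when_def)
  then have N: "effective N" "Poly_Mapping.keys N = Z"
    by (auto simp: effective_def in_keys_iff split: if_splits)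
  have ZK: "Z \<subseteq> points K" using Z(3) by blast
  obtain T where T: "T \<subseteq> sections Z 0" "finite T" "card T = card K ^ nat (divisor_degree K N)"
    "incongruent (sections Z (- N)) T" using semilocal_incongruent[OF Z(1) ZK N(1)] N(2) by blast
  have "int C = (\<Sum>v\<in>Z. 1)" using Z(2) by simp
  also have "\<dots> \<le> divisor_degree K N"
    unfolding divisor_degree_def N(2) using point_degree_pos ZK
    by (intro sum_mono) (auto simp: lookup int_one_le_iff_zero_less)
  finally have "C \<le> nat (divisor_degree K N)" by simp
  have "C < 2 ^ C" by (rule less_exp)
  also have "\<dots> \<le> card K ^ C" using two_le_card_K by (rule power_mono) simp
  also have "\<dots> \<le> card T"
    unfolding T(3) using two_le_card_K \<open>C \<le> nat (divisor_degree K N)\<close>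
    by (intro power_increasing) auto
  also have "\<dots> \<le> C"
  proof (rule index_leD[OF index_le_sections[OF ZK g C] T(1,2,4)])
    show "g \<in> sections Z 0" "g \<in> sections Z (- N)"
      using Z(3) by (auto simp: sections_def ord_ge_def lookup)
  qed
  finally show False by simp
qed

lemma finite_poles: "finite {v \<in> points K. v g < 0}"
proof (cases "g = 0")
  case True
  then have "{v \<in> points K. v g < 0} = {}" using point_zero[of _ K] by fastforce
  then show ?thesis by (simp only: finite.emptyI)
next
  case False
  then have "{v \<in> points K. v g < 0} = {v \<in> points K. 0 < v (inverse g)}"
    using point_inverse by fastforce
  then show ?thesis using finite_zeros[of "inverse g"] False by simp
qed

lemma pole_divisor_exists: "\<exists>E\<in>divisors K. effective E \<and> f \<in> RR_space K E"
proof (intro bexI conjI)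
  let ?Z = "{v \<in> points K. v f < 0}"
  let ?E = "\<Sum>v\<in>?Z. frag_cmul (- v f) (frag_of v)"
  have lookup: "Poly_Mapping.lookup ?E v = (if v \<in> ?Z then - v f else 0)" for v
    using finite_poles[of f]
    by (simp add: lookup_sum lookup_single when_def if_distrib cong: if_cong)
  show "effective ?E" unfolding effective_def lookup by simp
  show "f \<in> RR_space K ?E" unfolding RR_space_def lookup by auto
  show "?E \<in> divisors K" unfolding divisors_def by (auto simp: in_keys_iff lookup split: if_splits)
qed

lemma finite_subset_RR_space:
  assumes "finite T" shows "\<exists>E\<in>divisors K. effective E \<and> T \<subseteq> RR_space K E"
  using assms
proof (induction T)
  case empty
  show ?case by (intro bexI[of _ 0]) (simp_all add: effective_def divisors_zero)
next
  case (insert f T)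
  then obtain D E where D: "D \<in> divisors K" "effective D" "f \<in> RR_space K D"
    and E: "E \<in> divisors K" "effective E" "T \<subseteq> RR_space K E" using pole_divisor_exists by blast
  have "RR_space K D \<subseteq> RR_space K (D + E)" "RR_space K E \<subseteq> RR_space K (D + E)"
    using sections_subset_add_effective[OF E(2), of _ D] sections_subset_add_effective[OF D(2), of _ E]
    by (simp_all add: RR_space_eq_sections add.commute)
  then have "insert f T \<subseteq> RR_space K (D + E)" using D(3) E(3) by blast
  then show ?case
    using divisors_add[OF D(1) E(1)] effective_add[OF D(2) E(2)]
    by (intro bexI[of _ "D + E"]) simp_all
qed

lemma RR_space_zero: "RR_space K 0 = K"
proof
  show "RR_space K 0 \<subseteq> K"
  proof
    fix g assume g: "g \<in> RR_space K 0"
    show "g \<in> K"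
    proof (rule ccontr)
      assume "g \<notin> K"
      then obtain v where v: "v \<in> points K" "0 < v (inverse g)"
        using ex_point_pos[of "inverse g"] by auto
      then have "g \<noteq> 0" using point_zero[OF v(1)] by auto
      then have "v g < 0" using v point_inverse[OF v(1)] by simp
      then show False using g v(1) \<open>g \<noteq> 0\<close> by (auto simp: RR_space_def)
    qed
  qed
  show "K \<subseteq> RR_space K 0" using point_const by (force simp: RR_space_def)
qed

lemma RR_space_const_mult: "c \<in> K \<Longrightarrow> f \<in> RR_space K E \<Longrightarrow> c * f \<in> RR_space K E"
  using sections_mult[of "points K" K c 0 f E] RR_space_zero by (simp add: RR_space_eq_sections)

lemma index_le_sections_add_point:
  assumes v: "v \<in> points K" "v \<in> Z"
  shows "index_le (sections {v} D) (sections Z (D + frag_of v)) (card K ^ point_degree K v)"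
  unfolding index_le_def
proof (intro allI impI)
  obtain T where T: "residue_system (max_ideal v) (carrier (local_ring v)) T"
    using local_residue_system_exists[OF v(1)] ..
  obtain s where s: "s \<noteq> 0" "v s = Poly_Mapping.lookup D v + 1"
    using prescribed_orders[of "{v}" K "\<lambda>_. Poly_Mapping.lookup D v + 1"] v by auto
  have scaled: "ord_ge v k (f * s) \<longleftrightarrow> ord_ge v (k - Poly_Mapping.lookup D v - 1) f" for f k
    using ord_ge_mult_iff[OF v(1) s(1), of k f] s(2) by (simp add: algebra_simps)
  fix S assume S: "S \<subseteq> sections Z (D + frag_of v)" "incongruent (sections {v} D) S"
  have "incongruent (max_ideal v) ((\<lambda>f. f * s) ` S)"
    using S(2) scaled[of 1] unfolding incongruent_def
    by (auto simp: mem_max_ideal sections_def simp flip: left_diff_distrib)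
  moreover have "(\<lambda>f. f * s) ` S \<subseteq> carrier (local_ring v)"
  proof (rule image_subsetI)
    fix f assume "f \<in> S"
    then have "ord_ge v (- Poly_Mapping.lookup (D + frag_of v) v) f"
      using S(1) v(2) unfolding sections_def by blast
    then show "f * s \<in> carrier (local_ring v)"
      using scaled[of 0 f] by (simp add: mem_carrier_local_ring lookup_add)
  qed
  ultimately have "card ((\<lambda>f. f * s) ` S) \<le> card T"
    using card_incongruent_le[OF max_ideal_zero_closed max_ideal_diff_closed[OF v(1)] T] by blast
  moreover have "inj_on (\<lambda>f. f * s) S" using s(1) by (simp add: inj_on_def)
  ultimately show "card S \<le> card K ^ point_degree K v"
    using card_local_residue_system[OF v(1) T] by (simp add: card_image)
qed

lemma card_RR_space_add_point:
  assumes v: "v \<in> points K" and fin: "finite (RR_space K D)"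
  shows "finite (RR_space K (D + frag_of v)) \<and>
    card (RR_space K (D + frag_of v)) \<le> card K ^ point_degree K v * card (RR_space K D)"
proof -
  let ?L = "sections (points K) (D + frag_of v)"
  have inter: "?L \<inter> sections {v} D = RR_space K D"
    using sections_minus_point[OF v, of _ "D + frag_of v"]
    by (auto simp: RR_space_eq_sections sections_def[of "{v}"] lookup_add)
  have "finite ?L \<and> card ?L \<le> card K ^ point_degree K v * card (?L \<inter> sections {v} D)"
  proof (rule card_le_index_mult_card)
    show "index_le (sections {v} D) ?L (card K ^ point_degree K v)"
      by (rule index_le_sections_add_point[OF v v])
    show "f - g \<in> sections {v} D" if "f \<in> sections {v} D" "g \<in> sections {v} D" for f g
      using sections_diff[of "{v}" K] v that by simp
    show "f - g \<in> ?L" if "f \<in> ?L" "g \<in> ?L" for f g by (rule sections_diff[OF order_refl that])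
  qed (simp_all add: fin inter)
  then show ?thesis unfolding inter RR_space_eq_sections .
qed

lemma card_RR_space_effective:
  assumes "effective D" "D \<in> divisors K"
  shows "finite (RR_space K D) \<and> card (RR_space K D) \<le> card K ^ nat (divisor_degree K D + 1)"
  using assms
proof (induction D rule: effective_induct)
  case zero
  then show ?case using finite_K by (simp add: RR_space_zero divisor_degree_zero)
next
  case (add_point D v)
  then have D: "D \<in> divisors K" and v: "v \<in> points K"
    using keys_add_effective[OF add_point.hyps effective_point[of v]] by (auto simp: divisors_def)
  note IH = add_point.IH[OF D]
  have deg: "nat (divisor_degree K (D + frag_of v) + 1)
      = point_degree K v + nat (divisor_degree K D + 1)"
    using divisor_degree_nonneg[OF add_point.hyps, of K]
    by (simp add: divisor_degree_add divisor_degree_point nat_add_distrib)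
  have "card (RR_space K (D + frag_of v)) \<le> card K ^ point_degree K v * card (RR_space K D)"
    using card_RR_space_add_point[OF v] IH by blast
  also have "\<dots> \<le> card K ^ point_degree K v * card K ^ nat (divisor_degree K D + 1)"
    using IH by (intro mult_le_mono2) blast
  finally show ?case using card_RR_space_add_point[OF v] IH by (simp add: deg power_add)
qed

lemma card_digit_sums_RR_space:
  assumes A: "effective A" "A \<in> divisors K" "f \<in> RR_space K A" and T: "finite T"
  shows "\<exists>E. \<forall>m. card (digit_sums T f m) \<le> E * (card K ^ nat (divisor_degree K A)) ^ m"
proof -
  obtain E where E: "E \<in> divisors K" "effective E" "T \<subseteq> RR_space K E"
    using finite_subset_RR_space[OF T] by blast
  have "card (digit_sums T f m)
      \<le> card K ^ nat (divisor_degree K E + 1) * (card K ^ nat (divisor_degree K A)) ^ m" for m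
  proof -
    let ?D = "E + frag_cmul (int m) A"
    have D: "effective ?D" "?D \<in> divisors K"
      using A E by (simp_all add: effective_add effective_frag_cmul divisors_add divisors_frag_cmul)
    have "nat (divisor_degree K ?D + 1)
        = nat (divisor_degree K E + 1) + nat (divisor_degree K A) * m"
      using divisor_degree_nonneg[OF E(2), of K] divisor_degree_nonneg[OF A(1), of K]
      by (simp add: divisor_degree_add divisor_degree_frag_cmul nat_add_distrib nat_mult_distrib)
    moreover have "card (digit_sums T f m) \<le> card (RR_space K ?D)"
      using card_RR_space_effective[OF D] digit_sums_subset_RR_space[OF A(1,3) E(3)]
      by (intro card_mono) auto
    ultimately show ?thesis
      using card_RR_space_effective[OF D] by (simp add: power_add power_mult)
  qed
  then show ?thesis by blast
qed

text \<open>
  With digits from a largest incongruent set modulo \<open>N\<close>, the number of digit sums in \<open>f\<close> grows like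
  \<open>|K|\<close> to the power \<open>m deg N\<close>; they lie in spaces that grow like \<open>|K|\<close> to the power \<open>m deg A\<close>.
\<close>

lemma degree_le_if_section:
  assumes A: "effective A" "A \<in> divisors K" and N: "effective N" "N \<in> divisors K"
    and disjoint: "Poly_Mapping.keys A \<inter> Poly_Mapping.keys N = {}"
    and f: "f \<in> RR_space K (A - N)" "f \<noteq> 0"
  shows "divisor_degree K N \<le> divisor_degree K A"
proof -
  let ?Y = "Poly_Mapping.keys N"
  have Y: "finite ?Y" "?Y \<subseteq> points K" using N(2) by (auto simp: divisors_def)
  obtain T where T: "T \<subseteq> sections ?Y 0" "finite T" "card T = card K ^ nat (divisor_degree K N)"
    "incongruent (sections ?Y (- N)) T" using semilocal_incongruent[OF Y N(1)] by blast
  have f_RR: "f \<in> RR_space K A"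
    using f(1) sections_subset_add_effective[OF N(1), of "points K" "A - N"]
    by (auto simp: RR_space_eq_sections)
  have f_Y: "f \<in> sections ?Y (- N)"
    unfolding sections_def
  proof (intro CollectI ballI)
    fix P assume P: "P \<in> ?Y"
    then have "Poly_Mapping.lookup A P = 0" using disjoint by (auto simp: in_keys_iff)
    then show "ord_ge P (- Poly_Mapping.lookup (- N) P) f"
      using f P Y(2) by (fastforce simp: RR_space_def ord_ge_def lookup_minus)
  qed
  then have f_sub: "f \<in> sections ?Y 0"
    using sections_subset_add_effective[OF N(1), of ?Y "- N"] by auto
  obtain E where growth: "\<And>m. card (digit_sums T f m) \<le> E * (card K ^ nat (divisor_degree K A)) ^ m"
    using card_digit_sums_RR_space[OF A f_RR T(2)] by blast
  have "incongruent ((*) f ` sections ?Y 0) T"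
    by (rule incongruent_antimono[OF T(4) mult_sections_zero_subset[OF Y(2) f_Y]])
  from card_le_digit_growth[OF subring_sections_zero[OF Y(2)] f_sub f(2) T(1) this growth]
  have "card K ^ nat (divisor_degree K N) \<le> card K ^ nat (divisor_degree K A)" using T(3) by simp
  then show ?thesis using two_le_card_K divisor_degree_nonneg[OF A(1), of K]
    by (simp add: nat_le_eq_zle)
qed

theorem degree_nonneg_if_section:
  assumes D: "D \<in> divisors K" and f: "f \<in> RR_space K D" "f \<noteq> 0"
  shows "0 \<le> divisor_degree K D"
proof -
  define A where "A = Poly_Mapping.map (max 0) D"
  have A: "Poly_Mapping.lookup A P = max 0 (Poly_Mapping.lookup D P)" for P
    by (simp add: A_def Poly_Mapping.map.rep_eq when_def)
  have "divisor_degree K (A - D) \<le> divisor_degree K A"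
  proof (rule degree_le_if_section)
    show "effective A" "effective (A - D)" by (simp_all add: effective_def A lookup_minus)
    show "A \<in> divisors K" "A - D \<in> divisors K"
      using D by (auto simp: divisors_def in_keys_iff A lookup_minus)
    show "Poly_Mapping.keys A \<inter> Poly_Mapping.keys (A - D) = {}"
      by (auto simp: in_keys_iff A lookup_minus)
    show "f \<in> RR_space K (A - (A - D))" using f(1) by simp
  qed (rule f(2))
  then show ?thesis by (simp add: divisor_degree_diff)
qed

end

section \<open>Jumps of Riemann-Roch spaces\<close>

lemma RR_space_iff:
  "f \<in> RR_space K E \<longleftrightarrow> (\<forall>P\<in>points K. ord_ge P (- Poly_Mapping.lookup E P) f)"
  by (simp add: RR_space_eq_sections sections_def)

lemma RR_space_minus_point_subset: "RR_space K (E - frag_of v) \<subseteq> RR_space K E"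
  using sections_subset_add_effective[OF effective_point, of "points K" "E - frag_of v" v]
  by (simp add: RR_space_eq_sections)

lemma RR_space_effective_mono: "effective A \<Longrightarrow> RR_space K (- C) \<subseteq> RR_space K (A - C)"
  using sections_subset_add_effective[of A "points K" "- C"] by (simp add: RR_space_eq_sections)

lemma RR_space_nonzero_if_ne:
  assumes "RR_space K E' \<subseteq> RR_space K E" "RR_space K E \<noteq> RR_space K E'"
  obtains f where "f \<in> RR_space K E" "f \<noteq> 0"
proof -
  have "0 \<in> RR_space K E'" by (simp add: RR_space_eq_sections)
  then show ?thesis using assms that by (metis subset_antisym subsetI)
qed

definition jump :: "'f::field set \<Rightarrow> 'f point \<Rightarrow> 'f divisor \<Rightarrow> bool" where
  "jump K v E \<longleftrightarrow> RR_space K E \<noteq> RR_space K (E - frag_of v)"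

context finite_field_curve
begin

lemma RR_space_codimension_le_1:
  assumes v: "v \<in> rational_points K"
    and f: "f \<in> RR_space K E" "f \<notin> RR_space K (E - frag_of v)" and g: "g \<in> RR_space K E"
  shows "\<exists>c\<in>K. g - c * f \<in> RR_space K (E - frag_of v)"
proof -
  have vK: "v \<in> points K" using v by (simp add: rational_points_def)
  let ?k = "- Poly_Mapping.lookup E v"
  have f0: "f \<noteq> 0" using f(2) by (auto simp: RR_space_iff)
  have "\<not> ord_ge v (1 + ?k) f" using f sections_minus_point[OF vK]
    by (simp add: RR_space_eq_sections)
  moreover have ge: "ord_ge v ?k f" "ord_ge v ?k g" using f(1) g vK by (auto simp: RR_space_iff)
  ultimately have vf: "v f = ?k" using f0 by (auto simp: ord_ge_def)
  have "ord_ge v 0 (g / f)" using ord_ge_mult_iff[OF vK f0, of ?k "g / f"] ge(2) f0 vf by simp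
  then obtain c where c: "c \<in> K" "ord_ge v 1 (g / f - c)"
    using residue_system_covers[OF rational_point_residue_system[OF v], of "g / f"]
    by (auto simp: mem_carrier_local_ring mem_max_ideal)
  have "(g / f - c) * f = g - c * f" using f0 by (simp add: field_simps)
  then have "ord_ge v (1 + ?k) (g - c * f)"
    using ord_ge_mult_iff[OF vK f0, of "1 + ?k" "g / f - c"] c(2) vf by simp
  moreover have "g - c * f \<in> RR_space K E"
    using sections_diff[OF order_refl] g RR_space_const_mult[OF c(1) f(1)]
    by (simp add: RR_space_eq_sections)
  ultimately show ?thesis using c(1) sections_minus_point[OF vK]
    by (auto simp: RR_space_eq_sections)
qed

lemma last_difference_is_jump:
  assumes v: "v \<in> rational_points K" and A: "effective A"
    and ne: "RR_space K (A - C) \<noteq> RR_space K (- C)"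
    and eq: "RR_space K (A - C - frag_of v) = RR_space K (- C - frag_of v)"
  shows "jump K v (A - C)" and "\<not> jump K v (- C)"
proof -
  note sub = RR_space_minus_point_subset[of K "- C" v] RR_space_effective_mono[OF A, of K C]
  show "jump K v (A - C)" unfolding jump_def using ne eq sub by blast
  show "\<not> jump K v (- C)"
  proof
    assume "jump K v (- C)"
    then obtain f where f: "f \<in> RR_space K (- C)" "f \<notin> RR_space K (- C - frag_of v)"
      using sub(1) unfolding jump_def by blast
    have "g \<in> RR_space K (- C)" if g: "g \<in> RR_space K (A - C)" for g
    proof -
      have "f \<in> RR_space K (A - C)" "f \<notin> RR_space K (A - C - frag_of v)" using f eq sub(2) by blast+
      then obtain c where c: "c \<in> K" "g - c * f \<in> RR_space K (A - C - frag_of v)"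
        using RR_space_codimension_le_1[OF v _ _ g] by blast
      then have "g - c * f \<in> RR_space K (- C)" using eq sub(1) by blast
      then have "(g - c * f) + c * f \<in> RR_space K (- C)"
        using RR_space_const_mult[OF c(1) f(1)] sections_add[OF order_refl]
        by (metis RR_space_eq_sections)
      then show ?thesis by simp
    qed
    then show False using ne sub(2) by blast
  qed
qed

end

section \<open>Divisor classes\<close>

lemma linear_equivalence_iff:
  "(A, B) \<in> linear_equivalence K \<longleftrightarrow> A \<in> divisors K \<and> B \<in> divisors K \<and>
     (\<exists>f. f \<noteq> 0 \<and> (\<forall>P\<in>points K. Poly_Mapping.lookup A P - Poly_Mapping.lookup B P = P f))"
  by (simp add: linear_equivalence_def lookup_minus)

lemma equiv_linear_equivalence: "equiv (divisors K) (linear_equivalence K)"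
proof (rule equivI)
  show "linear_equivalence K \<subseteq> divisors K \<times> divisors K" by (auto simp: linear_equivalence_def)
  show "refl_on (divisors K) (linear_equivalence K)"
    using point_one by (force simp: refl_on_def linear_equivalence_iff intro: exI[of _ 1])
  show "sym (linear_equivalence K)"
  proof (rule symI)
    fix A B assume "(A, B) \<in> linear_equivalence K"
    then obtain f where f: "A \<in> divisors K" "B \<in> divisors K" "f \<noteq> 0"
      "\<And>P. P \<in> points K \<Longrightarrow> Poly_Mapping.lookup A P - Poly_Mapping.lookup B P = P f"
      unfolding linear_equivalence_iff by blast
    have "Poly_Mapping.lookup B P - Poly_Mapping.lookup A P = P (inverse f)" if "P \<in> points K" for P
      using f(4)[OF that] point_inverse[OF that f(3)] by simp
    then show "(B, A) \<in> linear_equivalence K"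
      unfolding linear_equivalence_iff using f(1-3) by (metis inverse_nonzero_iff_nonzero)
  qed
  show "trans (linear_equivalence K)"
  proof (rule transI)
    fix A B D assume "(A, B) \<in> linear_equivalence K" "(B, D) \<in> linear_equivalence K"
    then obtain f g where f: "A \<in> divisors K" "f \<noteq> 0"
      "\<And>P. P \<in> points K \<Longrightarrow> Poly_Mapping.lookup A P - Poly_Mapping.lookup B P = P f"
      and g: "D \<in> divisors K" "g \<noteq> 0"
      "\<And>P. P \<in> points K \<Longrightarrow> Poly_Mapping.lookup B P - Poly_Mapping.lookup D P = P g"
      unfolding linear_equivalence_iff by blast
    have "Poly_Mapping.lookup A P - Poly_Mapping.lookup D P = P (f * g)" if "P \<in> points K" for P
      using f(3)[OF that] g(3)[OF that] point_mult[OF that f(2) g(2)] by simp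
    then show "(A, D) \<in> linear_equivalence K"
      unfolding linear_equivalence_iff using f(1,2) g(1,2) by (metis mult_eq_0_iff)
  qed
qed

lemma linear_equivalence_diff_right:
  assumes "C \<in> divisors K" "A \<in> divisors K"
  shows "(A - C, B - C) \<in> linear_equivalence K \<longleftrightarrow> (A, B) \<in> linear_equivalence K"
proof -
  have "B - C \<in> divisors K \<longleftrightarrow> B \<in> divisors K"
    using divisors_diff[OF _ assms(1)] divisors_add[OF _ assms(1)] by (metis diff_add_cancel)
  then show ?thesis using assms by (simp add: linear_equivalence_iff lookup_minus divisors_diff)
qed

lemma divisor_class_members:
  assumes "a \<in> divisor_classes K" "A \<in> a"
  shows "A \<in> divisors K" "B \<in> a \<longleftrightarrow> (A, B) \<in> linear_equivalence K"
proof -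
  obtain A0 where A0: "A0 \<in> divisors K" "a = linear_equivalence K `` {A0}"
    using assms(1) unfolding divisor_classes_def by (auto elim: quotientE)
  then have A: "(A0, A) \<in> linear_equivalence K" using assms(2) by simp
  then show "A \<in> divisors K" by (simp add: linear_equivalence_iff)
  show "B \<in> a \<longleftrightarrow> (A, B) \<in> linear_equivalence K"
    using A A0(2) equiv_linear_equivalence[of K] unfolding equiv_def
    by (meson Image_singleton_iff symE transE)
qed

lemma class_minus_divisor_class:
  assumes a: "a \<in> divisor_classes K" and C: "C \<in> divisors K"
  shows "class_minus a C \<in> divisor_classes K"
proof -
  obtain A where A: "A \<in> divisors K" "a = linear_equivalence K `` {A}"
    using a unfolding divisor_classes_def by (auto elim: quotientE)
  note shift = linear_equivalence_diff_right[OF C A(1)]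
  have "class_minus a C = linear_equivalence K `` {A - C}"
  proof
    show "class_minus a C \<subseteq> linear_equivalence K `` {A - C}"
      using shift by (auto simp: class_minus_def A(2))
    show "linear_equivalence K `` {A - C} \<subseteq> class_minus a C"
    proof
      fix B assume "B \<in> linear_equivalence K `` {A - C}"
      then have "B + C \<in> a" using shift[of "B + C"] A(2) by simp
      then show "B \<in> class_minus a C" unfolding class_minus_def by (metis add_diff_cancel image_eqI)
    qed
  qed
  then show ?thesis using quotientI[of "A - C" "divisors K"] A(1) C divisors_diff
    unfolding divisor_classes_def by metis
qed

lemma RR_space_linear_equivalence:
  assumes "h \<noteq> 0"
    and "\<forall>P\<in>points K. Poly_Mapping.lookup A P - Poly_Mapping.lookup B P = P h"
  shows "f \<in> RR_space K A \<longleftrightarrow> f * h \<in> RR_space K B"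
  unfolding RR_space_iff
proof (rule ball_cong[OF refl])
  fix P assume P: "P \<in> points K"
  then have "- Poly_Mapping.lookup B P - P h = - Poly_Mapping.lookup A P" using assms(2) by force
  then show "ord_ge P (- Poly_Mapping.lookup A P) f = ord_ge P (- Poly_Mapping.lookup B P) (f * h)"
    using ord_ge_mult_iff[OF P assms(1)] by simp
qed

lemma jump_linear_equivalence:
  assumes "(A, B) \<in> linear_equivalence K" "jump K v A"
  shows "jump K v B"
proof -
  obtain h where h: "h \<noteq> 0"
    "\<forall>P\<in>points K. Poly_Mapping.lookup A P - Poly_Mapping.lookup B P = P h"
    using assms(1) unfolding linear_equivalence_iff by blast
  then have "\<forall>P\<in>points K.
      Poly_Mapping.lookup (A - frag_of v) P - Poly_Mapping.lookup (B - frag_of v) P = P h"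
    by (simp add: lookup_minus)
  then show ?thesis
    using RR_space_linear_equivalence[OF h] RR_space_linear_equivalence[OF h(1)] assms(2)
    unfolding jump_def by blast
qed

lemma Gamma_pt_iff:
  assumes "a \<in> divisor_classes K" "A \<in> a"
  shows "a \<in> Gamma_pt K v \<longleftrightarrow> jump K v A"
proof
  assume "a \<in> Gamma_pt K v"
  then obtain B where "B \<in> a" "jump K v B" unfolding Gamma_pt_def jump_def by blast
  then show "jump K v A"
    using jump_linear_equivalence divisor_class_members(2)[OF assms(1)] assms(2) by blast
qed (use assms in \<open>auto simp: Gamma_pt_def jump_def\<close>)

lemma Gamma_rel_iff:
  assumes "a \<in> Gamma_set K S" "A \<in> a" "C \<in> divisors K"
  shows "a \<in> Gamma_rel K v C S \<longleftrightarrow> jump K v (A - C)"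
proof -
  have a: "a \<in> divisor_classes K" using assms(1) by (simp add: Gamma_set_def)
  have "A - C \<in> class_minus a C" using assms(2) by (simp add: class_minus_def)
  from Gamma_pt_iff[OF class_minus_divisor_class[OF a assms(3)] this]
  show ?thesis using assms(1) by (simp add: Gamma_rel_def)
qed

context finite_field_curve
begin

lemma degree_linear_equivalence:
  assumes "(A, B) \<in> linear_equivalence K"
  shows "divisor_degree K A = divisor_degree K B"
proof -
  have le: "divisor_degree K B \<le> divisor_degree K A" if equiv: "(A, B) \<in> linear_equivalence K" for A B
  proof -
    obtain f where f: "A \<in> divisors K" "B \<in> divisors K" "f \<noteq> 0"
      "\<forall>P\<in>points K. Poly_Mapping.lookup A P - Poly_Mapping.lookup B P = P f"
      using equiv unfolding linear_equivalence_iff by blast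
    have "inverse f \<in> RR_space K (A - B)"
      using f(3,4) by (auto simp: RR_space_def lookup_minus point_inverse)
    from degree_nonneg_if_section[OF divisors_diff[OF f(1,2)] this]
    show ?thesis using f(3) by (simp add: divisor_degree_diff)
  qed
  have "(B, A) \<in> linear_equivalence K"
    using assms equiv_linear_equivalence[of K] unfolding equiv_def by (meson symE)
  then show ?thesis using le[OF assms] le[of B A] by simp
qed

lemma class_degree_eq:
  assumes "a \<in> divisor_classes K" "A \<in> a"
  shows "class_degree K a = divisor_degree K A"
proof -
  have "divisor_degree K B = divisor_degree K A" if "B \<in> a" for B
    using degree_linear_equivalence[of A B] divisor_class_members(2)[OF assms] that by simp
  then have "divisor_degree K ` a = (\<lambda>_. divisor_degree K A) ` a" by (rule image_cong[OF refl])
  also have "\<dots> = {divisor_degree K A}" using assms(2) by blast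
  finally show ?thesis by (simp add: class_degree_def)
qed

lemma degree_zero_section_principal:
  assumes A: "A \<in> divisors K" "divisor_degree K A = 0" and f: "f \<in> RR_space K A" "f \<noteq> 0"
  shows "(A, 0) \<in> linear_equivalence K"
proof -
  have "Poly_Mapping.lookup A P = P (inverse f)" if P: "P \<in> points K" for P
  proof (rule ccontr)
    assume ne: "Poly_Mapping.lookup A P \<noteq> P (inverse f)"
    have "0 \<le> P f + Poly_Mapping.lookup A P" using f P by (auto simp: RR_space_def)
    then have "ord_ge P (1 - Poly_Mapping.lookup A P) f"
      using ne point_inverse[OF P f(2)] by (auto simp: ord_ge_def)
    then have "f \<in> RR_space K (A - frag_of P)"
      using f(1) sections_minus_point[OF P] by (simp add: RR_space_eq_sections)
    then have "0 \<le> divisor_degree K (A - frag_of P)"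
      by (rule degree_nonneg_if_section[OF divisors_diff[OF A(1) divisors_point[OF P]] _ f(2)])
    then show False
      using A(2) point_degree_pos[OF P] by (simp add: divisor_degree_diff divisor_degree_point)
  qed
  then show ?thesis
    using A(1) f(2) divisors_zero
    by (auto simp: linear_equivalence_iff intro!: exI[of _ "inverse f"])
qed

lemma Gamma_pt_degree:
  assumes a: "a \<in> Gamma_pt K v"
  shows "0 \<le> class_degree K a" "class_degree K a = 0 \<Longrightarrow> 0 \<in> a"
proof -
  have cl: "a \<in> divisor_classes K" using a by (simp add: Gamma_pt_def)
  obtain A where A: "A \<in> a" "RR_space K A \<noteq> RR_space K (A - frag_of v)"
    using a unfolding Gamma_pt_def by blast
  obtain f where f: "f \<in> RR_space K A" "f \<noteq> 0"
    using RR_space_nonzero_if_ne[OF RR_space_minus_point_subset A(2)] .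
  have AK: "A \<in> divisors K" by (rule divisor_class_members(1)[OF cl A(1)])
  show "0 \<le> class_degree K a"
    using degree_nonneg_if_section[OF AK f] class_degree_eq[OF cl A(1)] by simp
  show "0 \<in> a" if "class_degree K a = 0"
    using degree_zero_section_principal[OF AK _ f] that class_degree_eq[OF cl A(1)]
      divisor_class_members(2)[OF cl A(1)] by simp
qed

end

section \<open>Minimal degrees\<close>

lemma min_degree_le: "a \<in> G \<Longrightarrow> min_degree K G \<le> ereal (of_int (class_degree K a))"
  unfolding min_degree_def by (rule INF_lower)

lemma min_degree_ge:
  "(\<And>a. a \<in> G \<Longrightarrow> k \<le> class_degree K a) \<Longrightarrow> ereal (of_int k) \<le> min_degree K G"
  unfolding min_degree_def by (rule INF_greatest) simp

context finite_field_curve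
begin

lemma gamma_pt_eq_0:
  assumes v: "v \<in> S" and C: "C \<in> divisors K" and zero: "gamma_pt K v C S = 0"
  shows "jump K v (- C)"
proof -
  have deg: "0 \<le> class_degree K a" "class_degree K a = 0 \<Longrightarrow> 0 \<in> a" if "a \<in> Gamma_rel K v C S" for a
    using that Gamma_pt_degree v by (auto simp: Gamma_rel_def Gamma_set_def)
  have "\<exists>a\<in>Gamma_rel K v C S. class_degree K a = 0"
  proof (rule ccontr)
    assume "\<not> ?thesis"
    then have "1 \<le> class_degree K a" if "a \<in> Gamma_rel K v C S" for a
      using deg(1)[OF that] that by force
    then have "ereal (of_int 1) \<le> gamma_pt K v C S"
      unfolding gamma_pt_def by (rule min_degree_ge)
    then show False using zero by simp
  qed
  then obtain a where a: "a \<in> Gamma_rel K v C S" "0 \<in> a" using deg(2) by blast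
  moreover have "a \<in> Gamma_set K S" using a(1) by (simp add: Gamma_rel_def)
  ultimately show ?thesis using Gamma_rel_iff[of a K S 0 C v] C by simp
qed

lemma effective_degree_pos:
  assumes "effective A" "A \<in> divisors K" "A \<noteq> 0"
  shows "1 \<le> divisor_degree K A"
proof -
  obtain P where P: "P \<in> Poly_Mapping.keys A"
    using assms(3) by (metis all_not_in_conv keys_eq_empty)
  have "0 < Poly_Mapping.lookup A P * int (point_degree K P)"
  proof (rule mult_pos_pos)
    show "0 < Poly_Mapping.lookup A P"
      using assms(1) P by (simp add: effective_def in_keys_iff order_less_le)
    show "0 < int (point_degree K P)"
      using assms(2) P point_degree_pos[of P] by (auto simp: divisors_def)
  qed
  also have "\<dots> \<le> divisor_degree K A"
    unfolding divisor_degree_def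
    by (rule member_le_sum) (use P assms(1) in \<open>simp_all add: effective_def\<close>)
  finally show ?thesis by simp
qed

lemma Gamma_star_effective:
  assumes "a \<in> Gamma_star K C S"
  obtains A where "A \<in> a" "A \<in> divisors K" "effective A" "RR_space K (A - C) \<noteq> RR_space K (- C)"
    "class_degree K a = divisor_degree K A"
proof -
  obtain A where A: "A \<in> a" "effective A" "RR_space K (A - C) \<noteq> RR_space K (- C)"
    and cl: "a \<in> divisor_classes K" using assms unfolding Gamma_star_def Gamma_set_def by blast
  show ?thesis
    by (rule that[OF A(1) divisor_class_members(1)[OF cl A(1)] A(2,3) class_degree_eq[OF cl A(1)]])
qed

lemma gamma_star_ge_1: "1 \<le> gamma_star K C S"
proof -
  have "1 \<le> class_degree K a" if a: "a \<in> Gamma_star K C S" for a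
    using a
  proof (rule Gamma_star_effective)
    fix A assume A: "A \<in> divisors K" "effective A" "RR_space K (A - C) \<noteq> RR_space K (- C)"
      "class_degree K a = divisor_degree K A"
    then have "A \<noteq> 0" by auto
    then show ?thesis using effective_degree_pos A by simp
  qed
  then have "ereal (of_int 1) \<le> gamma_star K C S" unfolding gamma_star_def by (rule min_degree_ge)
  then show ?thesis by (simp add: one_ereal_def)
qed

lemma gamma_star_ge_degree:
  assumes C: "C \<in> divisors K" shows "ereal (of_int (divisor_degree K C)) \<le> gamma_star K C S"
  unfolding gamma_star_def
proof (rule min_degree_ge)
  fix a assume "a \<in> Gamma_star K C S"
  then obtain A where A: "A \<in> divisors K" "effective A" "RR_space K (A - C) \<noteq> RR_space K (- C)"
    "class_degree K a = divisor_degree K A" by (rule Gamma_star_effective)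
  obtain f where f: "f \<in> RR_space K (A - C)" "f \<noteq> 0"
    using RR_space_nonzero_if_ne[OF RR_space_effective_mono[OF A(2)] A(3)] .
  from degree_nonneg_if_section[OF divisors_diff[OF A(1) C] f]
  show "divisor_degree K C \<le> class_degree K a" using A(4) by (simp add: divisor_degree_diff)
qed

lemma Gamma_star_step:
  assumes v: "v \<in> rational_points K" "v \<in> S" and C: "C \<in> divisors K"
    and a: "a \<in> Gamma_star K C S" "a \<notin> Gamma_star K (C + frag_of v) S"
  shows "a \<in> Gamma_rel K v C S" "gamma_pt K v C S \<noteq> 0"
proof -
  have set: "a \<in> Gamma_set K S" using a(1) by (simp add: Gamma_star_def)
  obtain A where A: "A \<in> a" "effective A" "RR_space K (A - C) \<noteq> RR_space K (- C)"
    using a(1) by (rule Gamma_star_effective)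
  have "RR_space K (A - (C + frag_of v)) = RR_space K (- (C + frag_of v))"
    using a(2) set A(1,2) unfolding Gamma_star_def by blast
  then have "RR_space K (A - C - frag_of v) = RR_space K (- C - frag_of v)"
    by (simp add: diff_diff_eq)
  note jump = last_difference_is_jump[OF v(1) A(2,3) this]
  show "a \<in> Gamma_rel K v C S" using Gamma_rel_iff[OF set A(1) C] jump(1) by blast
  show "gamma_pt K v C S \<noteq> 0" using gamma_pt_eq_0[OF v(2) C] jump(2) by blast
qed

context
  fixes S :: "'f point set" and C :: "'f divisor" and r :: nat and Q :: "nat \<Rightarrow> 'f point"
    and Cs :: "nat \<Rightarrow> 'f divisor"
  assumes S: "S \<subseteq> rational_points K" and C: "C \<in> divisors K" and Q: "\<And>i. i < r \<Longrightarrow> Q i \<in> S"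
    and Cs_0: "Cs 0 = C" and Cs_Suc: "\<And>i. i < r \<Longrightarrow> Cs (Suc i) = Cs i + frag_of (Q i)"
begin

lemma divisor_chain:
  "i \<le> r \<Longrightarrow> Cs i \<in> divisors K \<and> divisor_degree K (Cs i) = divisor_degree K C + int i"
proof (induction i)
  case (Suc i)
  then have "Q i \<in> points K" "point_degree K (Q i) = 1"
    using Q[of i] S by (auto simp: rational_points_def)
  then show ?case
    using Suc
    by (simp add: Cs_Suc divisors_add divisors_point divisor_degree_add divisor_degree_point)
qed (simp add: Cs_0 C)

lemma Gamma_star_chain:
  assumes "a \<in> Gamma_star K C S" "i \<le> r"
  shows "a \<in> Gamma_star K (Cs i) S \<or>
    (\<exists>j<i. a \<in> Gamma_rel K (Q j) (Cs j) S \<and> gamma_pt K (Q j) (Cs j) S \<noteq> 0)"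
  using assms(2)
proof (induction i)
  case (Suc i)
  then have i: "i < r" by simp
  note step = Gamma_star_step[OF subsetD[OF S Q[OF i]] Q[OF i], of "Cs i" a]
  show ?case using Suc.IH step divisor_chain[of i] i Cs_Suc[OF i] less_Suc_eq by auto
qed (simp add: Cs_0 assms(1))

lemma ex_gamma_le_class_degree:
  assumes "a \<in> Gamma_star K C S"
  shows "\<exists>m\<in>((\<lambda>i. gamma_pt K (Q i) (Cs i) S) ` {..<r} \<union> {gamma_star K (Cs r) S}) - {0}.
    m \<le> ereal (of_int (class_degree K a))"
proof -
  consider "a \<in> Gamma_star K (Cs r) S"
    | i where "i < r" "a \<in> Gamma_rel K (Q i) (Cs i) S" "gamma_pt K (Q i) (Cs i) S \<noteq> 0"
    using Gamma_star_chain[OF assms order_refl] by blast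
  then show ?thesis
  proof cases
    case 1
    then have "gamma_star K (Cs r) S \<le> ereal (of_int (class_degree K a))"
      unfolding gamma_star_def by (rule min_degree_le)
    moreover have "gamma_star K (Cs r) S \<noteq> 0" using gamma_star_ge_1[of "Cs r" S] by auto
    ultimately show ?thesis by blast
  next
    case 2
    from 2(2) have "gamma_pt K (Q i) (Cs i) S \<le> ereal (of_int (class_degree K a))"
      unfolding gamma_pt_def by (rule min_degree_le)
    then show ?thesis using 2(1,3) by blast
  qed
qed

end

end

theorem proposition6p1:
  fixes K :: "'f::field set"
    and S :: "'f point set"
    and C :: "'f divisor"
    and r :: nat
    and Q :: "nat \<Rightarrow> 'f point"
    and Cs :: "nat \<Rightarrow> 'f divisor"
  assumes "finite_field_curve K"
    and "finite S" and "S \<subseteq> rational_points K"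
    and "C \<in> divisors K"
    and "\<And>i. i < r \<Longrightarrow> Q i \<in> S"
    and "Cs 0 = C"
    and "\<And>i. i < r \<Longrightarrow> Cs (Suc i) = Cs i + frag_of (Q i)"
  shows "gamma_star K C S \<ge>
           Min (((\<lambda>i. gamma_pt K (Q i) (Cs i) S) ` {..<r} \<union> {gamma_star K (Cs r) S}) - {0})
       \<and> gamma_star K (Cs r) S \<ge> ereal (of_int (divisor_degree K C + int r))"
proof
  interpret finite_field_curve K by fact
  note chain = assms(3-7)
  show "gamma_star K (Cs r) S \<ge> ereal (of_int (divisor_degree K C + int r))"
    using gamma_star_ge_degree[of "Cs r" S] divisor_chain[OF chain, of r r] by simp
  let ?M = "((\<lambda>i. gamma_pt K (Q i) (Cs i) S) ` {..<r} \<union> {gamma_star K (Cs r) S}) - {0}"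
  show "gamma_star K C S \<ge> Min ?M"
    unfolding gamma_star_def[of K C] min_degree_def
  proof (rule INF_greatest)
    fix a assume "a \<in> Gamma_star K C S"
    from ex_gamma_le_class_degree[OF chain this]
    obtain m where m: "m \<in> ?M" "m \<le> ereal (of_int (class_degree K a))" by blast
    have "finite ?M" by simp
    then have "Min ?M \<le> m" using m(1) by (rule Min_le)
    then show "Min ?M \<le> ereal (of_int (class_degree K a))" using m(2) by (rule order_trans)
  qed
qed

end
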